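(* Let $G=(V,E)$ be any finite (not necessarily bipartite) graph, and for every vertex $u\in V$ fix an arbitrary strict total order (its preference order) over $V\setminus\{u\}$. Run the Random Decision Order (RDO) algorithm on $G$ with these preference orders. Then $\mathbb{E}[|M|]\ge 0.531\cdot|M^*|$, where $M$ is the (random) matching output by RDO and $M^*$ is a maximum matching of $G$.
   Context: Random Decision Order (RDO): every vertex $u$ independently draws a rank (decision time) $y_u$ uniformly from $[0,1]$. Vertices are processed in ascending order of their ranks, starting from the empty matching. When vertex $u$ is processed, if $u$ is still unmatched and has at least one unmatched neighbor in $G$, then $u$ is matched to the unmatched neighbor that comes first in $u$'s preference order; otherwise nothing happens. The preference orders are fixed in advance and do not depend on the ranks. *)

theory Defs
  imports "HOL-Probability.Probability" "Graph_Theory.Pair_Digraph"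
begin

text \<open>
  A finite simple undirected graph is a finite, loop-free, symmetric digraph
  (\<^locale>\<open>pair_graph\<close>). Both orientations of an edge are arcs, so matchings are sets of
  unordered pairs: \<open>card M\<close> then counts every edge once.
\<close>

definition matching :: "'a pair_pre_digraph \<Rightarrow> 'a set set \<Rightarrow> bool" where
  "matching G M \<longleftrightarrow> M \<subseteq> {{u, v} | u v. (u, v) \<in> parcs G} \<and> pairwise disjnt M"

definition maximum_matching :: "'a pair_pre_digraph \<Rightarrow> 'a set set \<Rightarrow> bool" where
  "maximum_matching G M \<longleftrightarrow> matching G M \<and> (\<forall>M'. matching G M' \<longrightarrow> card M' \<le> card M)"

definition unmatched_neighbors :: "'a pair_pre_digraph \<Rightarrow> 'a set set \<Rightarrow> 'a \<Rightarrow> 'a set" where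
  "unmatched_neighbors G M u = {v. (u, v) \<in> parcs G \<and> v \<notin> \<Union>M}"

text \<open>Orders are read as \<open>(v, w) \<in> r\<close> iff \<open>v\<close> comes before \<open>w\<close>.\<close>

definition first_in :: "'a rel \<Rightarrow> 'a set \<Rightarrow> 'a" where
  "first_in r A = (THE v. v \<in> A \<and> (\<forall>w \<in> A - {v}. (v, w) \<in> r))"

definition rdo_step ::
  "'a pair_pre_digraph \<Rightarrow> ('a \<Rightarrow> 'a rel) \<Rightarrow> 'a \<Rightarrow> 'a set set \<Rightarrow> 'a set set" where
  "rdo_step G pref u M =
     (if u \<notin> \<Union>M \<and> unmatched_neighbors G M u \<noteq> {}
      then insert {u, first_in (pref u) (unmatched_neighbors G M u)} M
      else M)"

text \<open>
  The choice below is unique when the ranks are pairwise distinct, which holds almost surely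
  for independent uniform ranks; the way ties are broken is irrelevant to the expectation.
\<close>

definition decision_order :: "'a set \<Rightarrow> ('a \<Rightarrow> real) \<Rightarrow> 'a list" where
  "decision_order V y = (SOME us. set us = V \<and> distinct us \<and> sorted (map y us))"

definition rdo :: "'a pair_pre_digraph \<Rightarrow> ('a \<Rightarrow> 'a rel) \<Rightarrow> ('a \<Rightarrow> real) \<Rightarrow> 'a set set" where
  "rdo G pref y = fold (rdo_step G pref) (decision_order (pverts G) y) {}"

definition rank_measure :: "'a set \<Rightarrow> ('a \<Rightarrow> real) measure" where
  "rank_measure V = (\<Pi>\<^sub>M u\<in>V. uniform_measure lborel {0..1})"

end

theory Submission
  imports Defs
begin

text \<open>
  Split the unit gained by each match between its active and its passive endpoint, as a function of
  the time \<open>t\<close> of the match. It suffices that for every edge \<open>uv\<close> of the maximum matching, and for all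
  fixed ranks of the other vertices, the expected joint share of \<open>u\<close> and \<open>v\<close> over their own two ranks is
  at least \<open>0.531\<close>. Let \<open>p\<close> be the first time another vertex would take \<open>u\<close> or \<open>v\<close>. If one of the two
  acts before \<open>p\<close>, it is matched; the other one is matched too if it would take its partner, or if it
  has two other candidates at its turn (the runs with and without its partner differ in one
  vertex only), or if both have a single candidate and these are different. The remaining case is
  a triangle: \<open>u\<close> and \<open>v\<close> both see, besides each other, only the same vertex \<open>z\<close>. Then \<open>z\<close> is matched
  whatever its own partner does, so it can afford to pay part of its share to \<open>u\<close> and \<open>v\<close>. The share
  functions are chosen such that the resulting one-dimensional integral inequality holds for all \<open>p\<close>.
\<close>

section \<open>Runs of a greedy matching process\<close>

text \<open>The difficulty is the partner that acts second: the first action disturbs the run of all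
  other vertices, so it is unknown when and in which role the second one is matched. Hence
  \<open>al\<close> decreases and stays below \<open>be - ka\<close>: a vertex known only to be
  matched by time \<open>t\<close> is credited with \<open>al t\<close>. Besides the first actor's
  share, an extra density \<open>slack t\<close> is needed before \<open>p\<close>. It comes from
  \<open>t * al t\<close> if a second actor at \<open>t\<close> is matched anyway, from
  \<open>(1 - t) * be t\<close> if the first actor takes its partner, from
  \<open>2 * (1 - t) * ka t\<close> in a triangle; for two different single candidates the
  comparison holds only after integration. The first and the last term agree up to 2/3, where
  \<open>ka \<le> be - al\<close> becomes tight with \<open>be = 2/3\<close>,
  \<open>al = ka = 1/3\<close>; from there on these functions are frozen. At \<open>p = 0\<close>
  the bound is \<open>be 0 = 0.532\<close>. A payer's pair loses \<open>ka p\<close> on the square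
  where both act after \<open>p\<close>. This is recovered on the rectangle where the partner acts
  before and the payer after \<open>p\<close>: there the payer is still matched and earns at least
  \<open>al 1 = 1/3\<close>.\<close>

locale greedy =
  fixes N :: "'a \<Rightarrow> 'a set" and top :: "'a \<Rightarrow> 'a set \<Rightarrow> 'a"
  assumes N_sym: "x \<in> N w \<Longrightarrow> w \<in> N x"
    and N_irrefl: "w \<notin> N w"
    and top_in: "X \<noteq> {} \<Longrightarrow> X \<subseteq> N w \<Longrightarrow> top w X \<in> X"
    and top_mono: "Y \<subseteq> X \<Longrightarrow> X \<subseteq> N w \<Longrightarrow> top w X \<in> Y \<Longrightarrow> top w Y = top w X"
begin

text \<open>The state is the set of unmatched vertices rather than the matching, so that two runs
  can be compared as sets.\<close>

definition step :: "'a \<Rightarrow> 'a set \<Rightarrow> 'a set" where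
  "step w A = (if w \<in> A \<and> N w \<inter> A \<noteq> {} then A - {w, top w (N w \<inter> A)} else A)"

abbreviation run :: "'a list \<Rightarrow> 'a set \<Rightarrow> 'a set" where
  "run L A \<equiv> fold step L A"

lemma top_Int: "N w \<inter> A \<noteq> {} \<Longrightarrow> top w (N w \<inter> A) \<in> N w \<and> top w (N w \<inter> A) \<in> A"
  using top_in[of "N w \<inter> A" w] by blast

lemma top_Int_mono: "A' \<subseteq> A \<Longrightarrow> top w (N w \<inter> A) \<in> A' \<Longrightarrow> N w \<inter> A \<noteq> {} \<Longrightarrow>
    top w (N w \<inter> A') = top w (N w \<inter> A)"
  using top_mono[of "N w \<inter> A'" "N w \<inter> A" w] top_Int[of w A] by blast

lemma step_subset: "step w A \<subseteq> A"
  by (auto simp: step_def)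

lemma run_subset: "run L A \<subseteq> A"
  by (induction L arbitrary: A) (use step_subset in fastforce)+

text \<open>A vertex that survives the step was neither active nor chosen, so by
  \<open>top_mono\<close> its deletion leaves the choice as it was.\<close>

lemma step_remove:
  assumes "x \<in> step w A"
  shows "step w (A - {x}) = step w A - {x}"
proof (cases "w \<in> A \<and> N w \<inter> A \<noteq> {}")
  case True
  define z where "z = top w (N w \<inter> A)"
  have z: "z \<in> N w" "z \<in> A" using top_Int[of w A] True by (auto simp: z_def)
  have st: "step w A = A - {w, z}" using True by (simp add: step_def z_def)
  have x: "x \<noteq> w" "x \<noteq> z" using assms st by auto
  have "top w (N w \<inter> (A - {x})) = z"
    unfolding z_def by (rule top_Int_mono) (use True z x in \<open>auto simp: z_def\<close>)
  moreover have "w \<in> A - {x}" "N w \<inter> (A - {x}) \<noteq> {}" using True z x by blast+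
  ultimately have "step w (A - {x}) = A - {x} - {w, z}" by (simp only: step_def simp_thms if_True)
  then show ?thesis using st by auto
next
  case False
  then show ?thesis by (auto simp: step_def)
qed

lemma run_remove: "x \<in> run L A \<Longrightarrow> run L (A - {x}) = run L A - {x}"
proof (induction L arbitrary: A)
  case (Cons w L)
  have "x \<in> step w A" using Cons.prems run_subset[of L "step w A"] by auto
  then show ?case using Cons by (simp add: step_remove)
qed simp

text \<open>Both directions are allowed because the extra vertex may change sides during a run, as
  along an alternating path.\<close>

definition near :: "'a set \<Rightarrow> 'a set \<Rightarrow> bool" where
  "near A A' \<longleftrightarrow> A = A' \<or> (\<exists>x. x \<notin> A' \<and> A = insert x A') \<or> (\<exists>x. x \<notin> A \<and> A' = insert x A)"

lemma near_sym: "near A A' \<Longrightarrow> near A' A"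
  by (auto simp: near_def)

lemma near_insert: "near (insert x A) A" "near A (insert x A)"
  by (cases "x \<in> A"; auto simp: near_def insert_absorb)+

text \<open>If the extra vertex acts, its choice becomes the new difference, on the other side. If
  it is chosen by \<open>w\<close>, the difference moves to the replacement that \<open>w\<close>
  takes in the smaller state, or to \<open>w\<close> itself if there is none. Otherwise both states
  make the same choice.\<close>

lemma near_step_insert:
  assumes "x \<notin> A'"
  shows "near (step w (insert x A')) (step w A')"
proof -
  let ?A = "insert x A'"
  consider (a) "w \<notin> ?A \<or> N w \<inter> ?A = {}" | (b) "w = x" "N w \<inter> ?A \<noteq> {}"
    | (c) "w \<noteq> x" "w \<in> A'" "N w \<inter> ?A \<noteq> {}" by auto
  then show ?thesis
  proof cases
    case a
    then show ?thesis using near_insert by (auto simp: step_def)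
  next
    case b
    define z where "z = top w (N w \<inter> ?A)"
    have z: "z \<in> N w" "z \<in> ?A" using top_Int[of w ?A] b by (auto simp: z_def)
    have "z \<noteq> x" using z b N_irrefl by auto
    have "step w ?A = A' - {z}" using b assms by (auto simp: step_def z_def)
    moreover have "A' = insert z (A' - {z})" using z \<open>z \<noteq> x\<close> by auto
    moreover have "step w A' = A'" using b assms by (simp add: step_def)
    ultimately show ?thesis using near_insert by metis
  next
    case c
    define z where "z = top w (N w \<inter> ?A)"
    have z: "z \<in> N w" "z \<in> ?A" using top_Int[of w ?A] c by (auto simp: z_def)
    have zw: "z \<noteq> w" using z N_irrefl by auto
    have s: "step w ?A = ?A - {w, z}" using c by (auto simp: step_def z_def)
    show ?thesis
    proof (cases "z = x")
      case True
      have s1: "step w ?A = A' - {w}" using s True c assms by auto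
      show ?thesis
      proof (cases "N w \<inter> A' = {}")
        case True
        then have "step w A' = insert w (A' - {w})" using c by (auto simp: step_def)
        then show ?thesis using s1 near_insert by metis
      next
        case False
        define z' where "z' = top w (N w \<inter> A')"
        have z': "z' \<in> N w" "z' \<in> A'" using top_Int[of w A'] False by (auto simp: z'_def)
        have "z' \<noteq> w" using z' N_irrefl by auto
        then have "A' - {w} = insert z' (A' - {w, z'})" using z' by auto
        moreover have "step w A' = A' - {w, z'}" using False c by (auto simp: step_def z'_def)
        ultimately show ?thesis using s1 near_insert by metis
      qed
    next
      case False
      then have "z \<in> A'" using z by auto
      then have "top w (N w \<inter> A') = z"
        unfolding z_def using c by (intro top_Int_mono) auto
      then have "step w A' = A' - {w, z}" using c z \<open>z \<in> A'\<close> by (auto simp: step_def)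
      moreover have "step w ?A = insert x (A' - {w, z})" using s False c by auto
      ultimately show ?thesis using near_insert by metis
    qed
  qed
qed

lemma near_step: "near A A' \<Longrightarrow> near (step w A) (step w A')"
proof -
  assume "near A A'"
  then consider "A = A'" | x where "x \<notin> A'" "A = insert x A'" | x where "x \<notin> A" "A' = insert x A"
    unfolding near_def by blast
  then show ?thesis
  proof cases
    case 1 then show ?thesis by (simp add: near_def)
  next
    case 2 then show ?thesis by (simp add: near_step_insert)
  next
    case 3 then show ?thesis by (simp add: near_step_insert near_sym)
  qed
qed

lemma near_run: "near A A' \<Longrightarrow> near (run L A) (run L A')"
  by (induction L arbitrary: A A') (auto simp: near_step)

text \<open>At its turn \<open>x\<close> would still have \<open>x'\<close> available, so it would
  be matched and could not survive.\<close>

lemma run_maximal: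
  assumes "x \<in> set L" "x \<in> run L A" "x' \<in> run L A"
  shows "x' \<notin> N x"
proof
  assume N: "x' \<in> N x"
  obtain L1 L2 where L: "L = L1 @ x # L2" using assms(1) by (auto dest: split_list)
  let ?A = "run L1 A"
  have "run L A \<subseteq> step x ?A" using run_subset[of L2 "step x ?A"] L by simp
  then have xs: "x \<in> step x ?A" "x' \<in> step x ?A" using assms by auto
  then have "x \<in> ?A" "x' \<in> ?A" using step_subset by blast+
  then have "x \<notin> step x ?A" using N by (auto simp: step_def)
  then show False using xs by simp
qed

text \<open>Whichever step removes \<open>w\<close> matches it along its only available edge and
  removes \<open>u\<close> too; while \<open>u\<close> survives, this edge stays the only
  one.\<close>

lemma run_leaf:
  assumes "w \<in> A" "N w \<inter> A = {u}" "u \<in> run L A"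
  shows "w \<in> run L A"
  using assms
proof (induction L arbitrary: A)
  case (Cons q L)
  let ?A = "step q A"
  have u: "u \<in> ?A" using Cons.prems run_subset[of L ?A] by auto
  have wu: "w \<noteq> u" using Cons.prems N_irrefl by auto
  have "w \<in> ?A"
  proof (rule ccontr)
    assume "w \<notin> ?A"
    then have c: "q \<in> A" "N q \<inter> A \<noteq> {}" "w = q \<or> w = top q (N q \<inter> A)" "?A = A - {q, top q (N q \<inter> A)}"
      using Cons.prems(1) by (auto simp: step_def split: if_splits)
    have t: "top q (N q \<inter> A) \<in> N q" "top q (N q \<inter> A) \<in> A" using top_Int[of q A] c by auto
    from c(3) show False
    proof
      assume "w = q"
      then have "top q (N q \<inter> A) = u" using t Cons.prems by auto
      then show False using u c by auto
    next
      assume "w = top q (N q \<inter> A)"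
      then have "q \<in> N w \<inter> A" using t c N_sym by auto
      then have "q = u" using Cons.prems by auto
      then show False using u c by auto
    qed
  qed
  moreover have "N w \<inter> ?A = {u}" using Cons.prems(2) u step_subset[of q A] by auto
  ultimately show ?case using Cons.IH[of ?A] Cons.prems by simp
qed simp

end

section \<open>Dividing the unit of each match between its endpoints\<close>

locale greedy_shares = greedy N top
  for N :: "'a \<Rightarrow> 'a set" and top +
  fixes P :: "'a \<Rightarrow> 'a \<Rightarrow> bool" and al be ka :: "real \<Rightarrow> real"
  assumes P_sym: "P x y \<Longrightarrow> P y x"
    and P_fun: "P x y \<Longrightarrow> P x z \<Longrightarrow> y = z"
    and P_N: "P x y \<Longrightarrow> y \<in> N x"
    and al_be: "al t + be t = 1"
    and al_antimono: "s \<le> t \<Longrightarrow> al t \<le> al s"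
    and al_nonneg: "0 \<le> al t"
    and ka_nonneg: "0 \<le> ka t"
    and ka_le: "al t \<le> be t - ka t"
begin

text \<open>
  The active vertex \<open>w\<close> takes \<open>x\<close> and thereby isolates its partner \<open>w'\<close>. In this case \<open>x\<close> pays
  \<open>ka\<close> to \<open>w\<close>; the payment is affordable since \<open>x\<close> is then matched whatever its own partner does
  (\<open>sh_robust\<close> below).
\<close>

definition tri :: "'a \<Rightarrow> 'a \<Rightarrow> 'a set \<Rightarrow> bool" where
  "tri w x A \<longleftrightarrow> (\<exists>w'. P w w' \<and> w' \<noteq> x \<and> N w \<inter> A = {w', x} \<and> N w' \<inter> A = {w, x})"

definition bonus :: "'a \<Rightarrow> 'a \<Rightarrow> 'a set \<Rightarrow> real \<Rightarrow> real" where
  "bonus w x A t = (if tri w x A then ka t else 0)"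

fun share :: "'a \<Rightarrow> 'a list \<Rightarrow> 'a set \<Rightarrow> ('a \<Rightarrow> real) \<Rightarrow> real" where
  "share q [] A y = 0"
| "share q (w # L) A y =
     (if w \<in> A \<and> N w \<inter> A \<noteq> {} then
        (if q = w then al (y w) + bonus w (top w (N w \<inter> A)) A (y w)
         else if q = top w (N w \<inter> A) then be (y w) - bonus w (top w (N w \<inter> A)) A (y w)
         else share q L (step w A) y)
      else share q L A y)"

lemma share_idle: "\<not> (w \<in> A \<and> N w \<inter> A \<noteq> {}) \<Longrightarrow> share q (w # L) A y = share q L A y"
  by (simp only: share.simps if_False)

lemma bonus_bounds: "0 \<le> bonus w x A t" "al t \<le> be t - bonus w x A t"
  using ka_nonneg[of t] ka_le[of t] by (auto simp: bonus_def)

lemma share_nonneg: "0 \<le> share q L A y"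
proof (induction L arbitrary: A)
  case (Cons w L)
  let ?x = "top w (N w \<inter> A)"
  have "0 \<le> al (y w) + bonus w ?x A (y w)" "0 \<le> be (y w) - bonus w ?x A (y w)"
    using bonus_bounds(1)[of w ?x A "y w"] bonus_bounds(2)[where w=w and x="?x" and A=A and t="y w"]
      al_nonneg[of "y w"] by linarith+
  then show ?case using Cons by simp
qed simp

lemma share_append_alive: "q \<in> run L1 A \<Longrightarrow> share q (L1 @ L2) A y = share q L2 (run L1 A) y"
proof (induction L1 arbitrary: A)
  case (Cons w L)
  have "q \<in> step w A" using Cons.prems run_subset[of L "step w A"] by auto
  then have "w \<in> A \<and> N w \<inter> A \<noteq> {} \<Longrightarrow> q \<noteq> w \<and> q \<noteq> top w (N w \<inter> A)"
    by (auto simp: step_def)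
  moreover have "\<not> (w \<in> A \<and> N w \<inter> A \<noteq> {}) \<Longrightarrow> step w A = A" by (auto simp: step_def)
  ultimately show ?case using Cons by auto
qed simp

text \<open>The time and the role of the match are unknown here. Both roles give at least
  \<open>al\<close> at that time, the passive one even after paying (\<open>ka_le\<close>), and
  \<open>al\<close> is decreasing.\<close>

lemma share_matched:
  assumes "q \<in> A" "q \<notin> run L1 A" "\<And>w. w \<in> set L1 \<Longrightarrow> y w \<le> \<tau>"
  shows "al \<tau> \<le> share q (L1 @ L2) A y"
  using assms
proof (induction L1 arbitrary: A)
  case (Cons w L)
  let ?x = "top w (N w \<inter> A)"
  have w: "al \<tau> \<le> al (y w)" using al_antimono Cons.prems(3)[of w] by simp
  have b: "al \<tau> \<le> al (y w) + bonus w ?x A (y w)" "al \<tau> \<le> be (y w) - bonus w ?x A (y w)"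
    using w bonus_bounds(1)[of w ?x A "y w"] bonus_bounds(2)[where w=w and x="?x" and A=A and t="y w"] by linarith+
  show ?case
  proof (cases "w \<in> A \<and> N w \<inter> A \<noteq> {}")
    case True
    show ?thesis
    proof (cases "q = w \<or> q = ?x")
      case True
      then show ?thesis using b \<open>w \<in> A \<and> _\<close> by auto
    next
      case False
      then have "q \<in> step w A" using Cons.prems True by (auto simp: step_def)
      then have "al \<tau> \<le> share q (L @ L2) (step w A) y" using Cons by simp
      then show ?thesis using True False by simp
    qed
  next
    case False
    then have "step w A = A" by (auto simp: step_def)
    then have "al \<tau> \<le> share q (L @ L2) A y" using Cons by simp
    then show ?thesis using share_idle[OF False, of q "L @ L2" y] by simp
  qed
qed simp

text \<open>Every effective step removes two vertices and hands out exactly one unit: the bonus only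
  moves from one endpoint to the other.\<close>

lemma sum_share:
  assumes "finite A"
  shows "2 * (\<Sum>q\<in>A. share q L A y) = real (card A) - real (card (run L A))"
  using assms
proof (induction L arbitrary: A)
  case (Cons w L)
  show ?case
  proof (cases "w \<in> A \<and> N w \<inter> A \<noteq> {}")
    case True
    let ?x = "top w (N w \<inter> A)"
    have x: "?x \<in> N w" "?x \<in> A" using top_Int[of w A] True by auto
    then have xw: "?x \<noteq> w" using N_irrefl by auto
    have s: "step w A = A - {w, ?x}" using True by (simp add: step_def)
    have A: "A = insert w (insert ?x (step w A))" "w \<notin> insert ?x (step w A)" "?x \<notin> step w A"
      using s x True xw by auto
    have f: "finite (step w A)" using s Cons.prems by simp
    have split: "sum f A = f w + f ?x + sum f (step w A)" for f :: "'a \<Rightarrow> real"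
    proof -
      have "sum f (insert w (insert ?x (step w A))) = f w + (f ?x + sum f (step w A))"
        using A(2,3) f by simp
      then show ?thesis using A(1) by simp
    qed
    have "(\<Sum>q\<in>A. share q (w # L) A y) = share w (w # L) A y + share ?x (w # L) A y
        + (\<Sum>q\<in>step w A. share q (w # L) A y)"
      by (rule split)
    also have "share w (w # L) A y + share ?x (w # L) A y = 1"
      using True xw al_be[of "y w"] by simp
    also have "(\<Sum>q\<in>step w A. share q (w # L) A y) = (\<Sum>q\<in>step w A. share q L (step w A) y)"
      using True s by (intro sum.cong) auto
    finally have "2 * (\<Sum>q\<in>A. share q (w # L) A y) = 2 + (real (card (step w A)) - real (card (run L (step w A))))"
      using Cons.IH[OF f] by simp
    moreover have "card A = card (step w A) + 2"
    proof -
      have "card (insert w (insert ?x (step w A))) = card (step w A) + 2" using A(2,3) f by simp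
      then show ?thesis using A(1) by simp
    qed
    ultimately show ?thesis by simp
  next
    case False
    then have "step w A = A" by (auto simp: step_def)
    then show ?thesis using Cons by (simp add: share_idle[OF False] del: share.simps)
  qed
qed simp

end

lemma filter_less_split:
  fixes y :: "'a \<Rightarrow> real"
  assumes "sorted_wrt (\<lambda>a b. y a < y b) L" "s \<le> t"
  shows "filter (\<lambda>w. y w < t) L = filter (\<lambda>w. y w < s) L @ filter (\<lambda>w. s \<le> y w \<and> y w < t) L"
  using assms
proof (induction L)
  case (Cons w L)
  show ?case
  proof (cases "y w < s")
    case True
    then show ?thesis using Cons by auto
  next
    case False
    then have "filter (\<lambda>w. y w < s) L = []" using Cons.prems by (auto simp: filter_empty_conv)
    then show ?thesis using Cons False by auto
  qed
qed simp

lemma split_at_rank: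
  fixes y :: "'a \<Rightarrow> real"
  assumes "sorted_wrt (\<lambda>a b. y a < y b) L" "w \<in> set L"
  shows "L = filter (\<lambda>x. y x < y w) L @ w # filter (\<lambda>x. y w < y x) L"
proof -
  obtain L1 L2 where L: "L = L1 @ w # L2" using assms(2) by (auto dest: split_list)
  have "\<forall>x\<in>set L1. y x < y w" "\<forall>x\<in>set L2. y w < y x"
    using assms(1) by (auto simp: L sorted_wrt_append)
  then have "filter (\<lambda>x. y x < y w) L1 = L1" "filter (\<lambda>x. y x < y w) L2 = []"
    "filter (\<lambda>x. y w < y x) L1 = []" "filter (\<lambda>x. y w < y x) L2 = L2"
    by (auto simp: filter_empty_conv filter_id_conv)
  then show ?thesis by (simp add: L)
qed

section \<open>Shares of two partners as functions of their own ranks\<close>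

locale matched_pair = greedy_shares N top P al be ka
  for N :: "'a \<Rightarrow> 'a set" and top P al be ka +
  fixes u v :: 'a and Ls :: "'a list" and y :: "'a \<Rightarrow> real" and V :: "'a set"
  assumes P_uv: "P u v"
    and V: "V = insert u (insert v (set Ls))"
    and u_notin: "u \<notin> set Ls" and v_notin: "v \<notin> set Ls"
    and sorted: "sorted_wrt (\<lambda>a b. y a < y b) Ls"
begin

text \<open>
  The order \<open>ord s t\<close> inserts \<open>u\<close> at rank \<open>s\<close> and \<open>v\<close> at rank \<open>t\<close> into the fixed order \<open>Ls\<close> of the other
  vertices. \<open>R t\<close> is the set of unmatched vertices at time \<open>t\<close> when neither \<open>u\<close> nor \<open>v\<close> has been
  processed; since runs from nearby sets stay nearby, it controls the run for all \<open>s\<close> and \<open>t\<close>.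
\<close>

definition pre :: "real \<Rightarrow> 'a list" where "pre t = filter (\<lambda>w. y w < t) Ls"
definition mid :: "real \<Rightarrow> real \<Rightarrow> 'a list" where "mid s t = filter (\<lambda>w. s < y w \<and> y w < t) Ls"
definition post :: "real \<Rightarrow> 'a list" where "post t = filter (\<lambda>w. t < y w) Ls"
definition R :: "real \<Rightarrow> 'a set" where "R t = run (pre t) V"
definition free :: "real \<Rightarrow> bool" where "free t \<longleftrightarrow> u \<in> R t \<and> v \<in> R t"
definition ord :: "real \<Rightarrow> real \<Rightarrow> 'a list" where
  "ord s t = (if s < t then pre s @ u # mid s t @ v # post t else pre t @ v # mid t s @ u # post s)"
definition sh :: "'a \<Rightarrow> real \<Rightarrow> real \<Rightarrow> real" where
  "sh q s t = share q (ord s t) V (y(u := s, v := t))"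

lemma uv: "u \<noteq> v" "v \<in> N u" "u \<in> N v" "P v u"
  using P_N[OF P_uv] P_sym[OF P_uv] N_sym N_irrefl by auto

lemma pre_split:
  assumes "s < t" "s \<notin> y ` set Ls"
  shows "pre t = pre s @ mid s t"
proof -
  have "filter (\<lambda>w. s \<le> y w \<and> y w < t) Ls = mid s t"
    unfolding mid_def using assms(2) by (intro filter_cong) (auto simp: le_less)
  then show ?thesis using filter_less_split[OF sorted, of s t] assms by (simp add: pre_def)
qed

lemma pre_split_rank:
  assumes "w \<in> set Ls" "y w < t"
  shows "pre t = pre (y w) @ w # mid (y w) t"
proof -
  have "pre t = filter (\<lambda>x. y x < t) (pre (y w) @ w # post (y w))"
    unfolding pre_def post_def by (subst split_at_rank[OF sorted assms(1)]) simp
  also have "\<dots> = pre (y w) @ w # mid (y w) t"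
    using assms(2) unfolding pre_def post_def mid_def
    by (auto intro!: filter_cong simp: conj_commute)
  finally show ?thesis .
qed

lemma R_antimono: "s \<le> t \<Longrightarrow> R t \<subseteq> R s"
  using filter_less_split[OF sorted, of s t] run_subset by (simp add: R_def pre_def)

lemma free_antimono: "s \<le> t \<Longrightarrow> free t \<Longrightarrow> free s"
  using R_antimono[of s t] by (auto simp: free_def)

lemma R_mid: "s < t \<Longrightarrow> s \<notin> y ` set Ls \<Longrightarrow> R t = run (mid s t) (R s)"
  by (simp add: R_def pre_split)

lemma set_ord: "set (ord s t) \<subseteq> V"
  by (auto simp: ord_def pre_def mid_def post_def V)

lemma uvV: "u \<in> V" "v \<in> V" by (auto simp: V)



text \<open>The partner \<open>v\<close> is itself an available neighbour, so an acting
  \<open>u\<close> is always matched.\<close>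

lemma act_u:
  assumes "free s"
  shows "step u (R s) = R s - {u, top u (N u \<inter> R s)}" "top u (N u \<inter> R s) \<in> N u \<inter> R s"
  using assms uv top_Int[of u "R s"] by (auto simp: step_def free_def)

lemma sh_first:
  assumes "free s" "s < t"
  shows "sh u s t = al s + bonus u (top u (N u \<inter> R s)) (R s) s"
proof -
  have "sh u s t = share u (u # mid s t @ v # post t) (R s) (y(u := s, v := t))"
    using assms share_append_alive[of u "pre s" V] by (simp add: sh_def ord_def R_def free_def)
  then show ?thesis using assms uv by (auto simp: free_def)
qed

lemma sh_first_ge: "free s \<Longrightarrow> s < t \<Longrightarrow> al s \<le> sh u s t"
  using sh_first bonus_bounds(1) by simp

lemma sh_nonneg: "0 \<le> sh q s t"
  by (simp add: sh_def share_nonneg)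

lemma sh_triangle:
  assumes "free s" "s < t" "N u \<inter> R s = {v, z}" "N v \<inter> R s = {u, z}" "top u (N u \<inter> R s) \<noteq> v"
  shows "al s + ka s \<le> sh u s t"
proof -
  have "top u (N u \<inter> R s) = z" using act_u(2)[OF assms(1)] assms(3,5) by auto
  moreover have "tri u z (R s)" unfolding tri_def using P_uv assms calculation by metis
  ultimately show ?thesis using sh_first[OF assms(1,2)] by (simp add: bonus_def)
qed

text \<open>Both shares come from one match, whose unit stays inside the pair; \<open>tri\<close>
  excludes the partner as the chosen vertex, so nothing is paid.\<close>

lemma sh_top:
  assumes "free s" "s < t" "top u (N u \<inter> R s) = v"
  shows "sh u s t + sh v s t = 1"
proof -
  have "sh v s t = share v (u # mid s t @ v # post t) (R s) (y(u := s, v := t))"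
    using assms share_append_alive[of v "pre s" V] by (simp add: sh_def ord_def R_def free_def)
  moreover have "\<not> tri u v (R s)" unfolding tri_def using P_uv P_fun by metis
  moreover have "u \<in> R s" "N u \<inter> R s \<noteq> {}" using assms uv by (auto simp: free_def)
  ultimately have "sh v s t = be s" using assms uv by (simp add: bonus_def)
  then show ?thesis using sh_first[OF assms(1,2)] \<open>\<not> tri u v (R s)\<close> assms al_be by (simp add: bonus_def)
qed

lemma rank_le:
  assumes "s < t" "w \<in> set (pre s @ u # mid s t @ [v])"
  shows "(y(u := s, v := t)) w \<le> t"
  using assms by (auto simp: pre_def mid_def)

lemma sh_second:
  assumes "s < t" "v \<notin> run (pre s @ u # mid s t @ [v]) V"
  shows "al t \<le> sh v s t"
  using share_matched[OF uvV(2) assms(2), of "y(u := s, v := t)" t "post t"] rank_le[OF assms(1)] assms(1)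
  by (simp add: sh_def ord_def)

lemma sh_second_of_nbr:
  assumes "s < t" "v \<in> run (mid s t) (step u (R s)) \<Longrightarrow> N v \<inter> run (mid s t) (step u (R s)) \<noteq> {}"
  shows "al t \<le> sh v s t"
proof (rule sh_second[OF assms(1)])
  show "v \<notin> run (pre s @ u # mid s t @ [v]) V"
    using assms(2) by (auto simp: step_def R_def)
qed

text \<open>Deleting the surviving \<open>u\<close> does not disturb the run
  (\<open>run_remove\<close>). Deleting also the vertex chosen by \<open>u\<close> changes the state
  at \<open>t\<close> by at most one vertex (\<open>near_run\<close>), so one of \<open>a\<close>,
  \<open>b\<close> remains for \<open>v\<close>.\<close>

lemma sh_M:
  assumes "free t" "s < t" "s \<notin> y ` set Ls" "{a, b} \<subseteq> N v \<inter> R t - {u}" "a \<noteq> b"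
  shows "al s + al t \<le> sh u s t + sh v s t"
proof -
  have fs: "free s" using assms free_antimono[of s t] by simp
  have "al t \<le> sh v s t"
  proof (rule sh_second_of_nbr[OF assms(2)])
    let ?x = "top u (N u \<inter> R s)" and ?A = "run (mid s t) (step u (R s))"
    assume v: "v \<in> ?A"
    have "run (mid s t) (R s - {u}) = R t - {u}"
      using run_remove[of u "mid s t" "R s"] assms(1) R_mid[OF assms(2,3)] by (simp add: free_def)
    moreover have "R s - {u} = insert ?x (R s - {u, ?x})" using act_u[OF fs] N_irrefl by auto
    then have "near (R s - {u}) (step u (R s))" using near_insert(1)[of ?x "R s - {u, ?x}"] act_u[OF fs] by simp
    ultimately have "near (R t - {u}) ?A" using near_run by metis
    moreover have "a \<in> R t - {u}" "b \<in> R t - {u}" using assms(4) by auto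
    ultimately have "a \<in> ?A \<or> b \<in> ?A" unfolding near_def using assms(5) by (metis insert_iff)
    then show "N v \<inter> ?A \<noteq> {}" using assms(4) by auto
  qed
  then show ?thesis using sh_first_ge[OF fs assms(2)] by simp
qed

text \<open>The vertex chosen by \<open>u\<close> would have stayed unmatched up to \<open>t\<close>
  anyway. Hence \<open>run_remove\<close> applies to it as well, and the state at \<open>t\<close>
  loses exactly \<open>u\<close> and this vertex, but not \<open>z\<close>.\<close>

lemma sh_S:
  assumes "free t" "s < t" "s \<notin> y ` set Ls" "top u (N u \<inter> R s) \<in> R t"
    "z \<in> N v \<inter> R t - {u}" "z \<noteq> top u (N u \<inter> R s)"
  shows "al s + al t \<le> sh u s t + sh v s t"
proof -
  have fs: "free s" using assms free_antimono[of s t] by simp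
  have "al t \<le> sh v s t"
  proof (rule sh_second_of_nbr[OF assms(2)])
    let ?x = "top u (N u \<inter> R s)"
    have xu: "?x \<noteq> u" using act_u(2)[OF fs] N_irrefl by auto
    have 1: "run (mid s t) (R s - {u}) = R t - {u}"
      using run_remove[of u "mid s t" "R s"] assms(1) R_mid[OF assms(2,3)] by (simp add: free_def)
    then have "run (mid s t) (R s - {u} - {?x}) = R t - {u} - {?x}"
      using run_remove[of ?x "mid s t" "R s - {u}"] assms(4) xu by simp
    moreover have "R s - {u} - {?x} = step u (R s)" using act_u[OF fs] by auto
    ultimately show "N v \<inter> run (mid s t) (step u (R s)) \<noteq> {}" using assms(5,6) by auto
  qed
  then show ?thesis using sh_first_ge[OF fs assms(2)] by simp
qed

lemma sh_taken:
  assumes "w \<in> set Ls" "y w < s" "y w < t" "free (y w)" "w \<in> R (y w)" "top w (N w \<inter> R (y w)) = u" "w \<in> N u"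
  shows "be (y w) - bonus w u (R (y w)) (y w) \<le> sh u s t"
proof -
  let ?p = "y w"
  have w: "w \<noteq> u" "w \<noteq> v" using assms u_notin v_notin by auto
  have "\<exists>L. ord s t = pre ?p @ w # L"
    using pre_split_rank[OF assms(1,2)] pre_split_rank[OF assms(1,3)] by (cases "s < t") (simp_all add: ord_def)
  then obtain L where L: "ord s t = pre ?p @ w # L" by blast
  have "sh u s t = share u (w # L) (R ?p) (y(u := s, v := t))"
    using share_append_alive[of u "pre ?p" V "w # L"] assms(4) by (simp add: sh_def L R_def free_def)
  moreover have "N w \<inter> R ?p \<noteq> {}" using assms N_sym[of w u] by (auto simp: free_def)
  ultimately show ?thesis using assms w by simp
qed

text \<open>Here \<open>u\<close> is the vertex that pays in a triangle with \<open>w\<close> and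
  its partner \<open>w'\<close>. An early action of \<open>v\<close> changes the state by at most
  one vertex; either \<open>w\<close> still takes \<open>u\<close>, or \<open>w\<close> drops out
  without \<open>w'\<close>, whose only remaining candidate is then \<open>u\<close>. Maximality
  forbids leaving both unmatched.\<close>

lemma sh_robust:
  assumes "w \<in> set Ls" "t < y w" "y w < s" "t \<notin> y ` set Ls" "free (y w)" "tri w u (R (y w))"
    "w \<in> R (y w)" "top w (N w \<inter> R (y w)) = u" "\<And>x. x \<in> set Ls \<Longrightarrow> y x \<le> 1" "s \<le> 1"
    "set (ord s t) = V"
  shows "al 1 \<le> sh u s t"
proof -
  let ?p = "y w"
  obtain w' where w': "P w w'" "w' \<noteq> u" "N w \<inter> R ?p = {w', u}" "N w' \<inter> R ?p = {w, u}"
    using assms(6) unfolding tri_def by blast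
  have wuv: "w \<noteq> u" "w \<noteq> v" using assms(1) u_notin v_notin by auto
  have w'v: "w' \<noteq> v" using w'(1) P_uv P_sym P_fun wuv by metis
  have ft: "free t" using assms free_antimono[of t ?p] by simp
  have fp: "u \<in> R ?p" "v \<in> R ?p" using assms(5) by (auto simp: free_def)
  have nv: "v \<notin> N w" "v \<notin> N w'" using w' fp w'v wuv uv by auto
  have ww': "w' \<in> R ?p" "w' \<noteq> w" "w \<in> N w'" using w' N_irrefl by auto
  have u_not: "u \<notin> run (ord s t) V"
  proof
    assume final: "u \<in> run (ord s t) V"
    let ?x = "top v (N v \<inter> R t)" and ?A = "run (mid t ?p) (step v (R t))"
    have x: "step v (R t) = R t - {v, ?x}" "?x \<in> N v \<inter> R t"
      using ft uv top_Int[of v "R t"] by (auto simp: step_def free_def)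
    have m: "mid t s = mid t ?p @ w # mid ?p s"
    proof -
      have "pre s = pre t @ mid t s" "pre s = pre ?p @ w # mid ?p s" "pre ?p = pre t @ mid t ?p"
        using pre_split[of t s] pre_split[of t ?p] pre_split_rank[of w s] assms by auto
      then show ?thesis by simp
    qed
    have o: "run (ord s t) V = run (mid ?p s @ u # post s) (step w ?A)"
    proof -
      have "\<not> s < t" using assms(2,3) by simp
      then have "ord s t = pre t @ v # (mid t ?p @ w # mid ?p s) @ u # post s" by (simp only: ord_def m if_False)
      then show ?thesis by (simp add: R_def)
    qed
    have uA: "u \<in> step w ?A"
      using final run_subset[of "mid ?p s @ u # post s" "step w ?A"] unfolding o by blast
    then have uA': "u \<in> ?A" using step_subset by blast
    have rt: "run (mid t ?p) (R t - {v}) = R ?p - {v}"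
      using run_remove[of v "mid t ?p" "R t"] fp R_mid[of t ?p] assms by simp
    have "R t - {v} = insert ?x (R t - {v, ?x})" using x N_irrefl by auto
    then have "near (R t - {v}) (step v (R t))" using near_insert(1)[of ?x "R t - {v, ?x}"] x by simp
    then have nr: "near (R ?p - {v}) ?A" using near_run[of "R t - {v}"] rt by metis
    \<comment> \<open>In both cases the state after the turn of \<open>w\<close> is
      \<open>R ?p\<close> without \<open>v\<close> and \<open>w\<close>.\<close>
    have "w' \<in> step w ?A \<and> N w' \<inter> step w ?A = {u}"
    proof (cases "w \<in> ?A")
      case True
      let ?z = "top w (N w \<inter> ?A)"
      have "u \<in> N w" using w' by auto
      then have ne: "N w \<inter> ?A \<noteq> {}" using uA' by auto
      have z: "?z \<in> N w" "?z \<in> ?A" "step w ?A = ?A - {w, ?z}"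
        using top_Int[OF ne] True ne by (auto simp: step_def)
      have zu: "?z \<noteq> u" using z uA by auto
      have "?z \<notin> R ?p - {v}"
      proof
        assume zR: "?z \<in> R ?p - {v}"
        then have "?z = w'" using w'(3) z zu by auto
        \<comment> \<open>In \<open>R ?p\<close> the vertex \<open>w\<close> preferred
          \<open>u\<close> to \<open>w'\<close>, so it cannot take \<open>w'\<close> while
          \<open>u\<close> is available.\<close>
        have "top w {w', u} = u" using assms(8) w' by simp
        moreover have "top w {w', u} = ?z"
          by (rule top_mono) (use \<open>?z = w'\<close> z uA' \<open>u \<in> N w\<close> in auto)
        ultimately show False using zu by simp
      qed
      \<comment> \<open>The single vertex of difference is thus \<open>?z\<close>, which disappears
        together with \<open>w\<close>.\<close>
      then have "?A = insert ?z (R ?p - {v})" using nr z(2) by (auto simp: near_def)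
      then have "step w ?A = R ?p - {v} - {w}" using z \<open>?z \<notin> R ?p - {v}\<close> by auto
      then show ?thesis using w' ww' w'v nv fp uv wuv by auto
    next
      case False
      then have "step w ?A = ?A" by (auto simp: step_def)
      have "w \<in> R ?p - {v}" using assms(7) wuv by auto
      then have "R ?p - {v} = insert w ?A"
        using nr False unfolding near_def by (metis insert_iff)
      then have "?A = R ?p - {v} - {w}" using False by (metis Diff_insert_absorb)
      then show ?thesis using \<open>step w ?A = ?A\<close> w' ww' w'v nv fp uv wuv by auto
    qed
    then have "w' \<in> run (ord s t) V"
      using run_leaf[of w' "step w ?A" u "mid ?p s @ u # post s"] final unfolding o by blast
    moreover have "w' \<in> set (ord s t)" using ww'(1) run_subset assms(11) by (auto simp: R_def)
    moreover have "u \<in> N w'" using w' by auto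
    ultimately show False using run_maximal[of w' "ord s t" V u] final by blast
  qed
  have "t \<le> 1" using assms(1,2) assms(9)[of w] by linarith
  then have "(y(u := s, v := t)) x \<le> 1" if "x \<in> set (ord s t)" for x
    using assms(9)[of x] assms(10) that set_ord[of s t] by (auto simp: V)
  then show ?thesis
    using share_matched[OF uvV(1) u_not, of "y(u := s, v := t)" 1 "[]"] by (simp add: sh_def)
qed

lemma set_ord_eq: "s \<noteq> t \<Longrightarrow> s \<notin> y ` set Ls \<Longrightarrow> t \<notin> y ` set Ls \<Longrightarrow> set (ord s t) = V"
  by (auto simp: ord_def pre_def mid_def post_def V image_iff)

text \<open>The order is split at the first step that removes \<open>u\<close> or \<open>v\<close>.
  Its actor lies in \<open>Ls\<close>, so it is neither of the two and must have chosen one of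
  them.\<close>

lemma taker_exists:
  assumes "\<not> free t"
  obtains w where "w \<in> set Ls" "y w < t" "free (y w)" "w \<in> R (y w)"
    "top w (N w \<inter> R (y w)) = u \<and> w \<in> N u \<or> top w (N w \<inter> R (y w)) = v \<and> w \<in> N v"
proof -
  have ex: "\<exists>L1 w L2. L = L1 @ w # L2 \<and> {u, v} \<subseteq> run L1 A \<and> \<not> {u, v} \<subseteq> step w (run L1 A)"
    if "{u, v} \<subseteq> A" "\<not> {u, v} \<subseteq> run L A" for L A
    using that
  proof (induction L arbitrary: A)
    case (Cons w L)
    show ?case
    proof (cases "{u, v} \<subseteq> step w A")
      case True
      have "\<not> {u, v} \<subseteq> run L (step w A)" using Cons.prems(2) by simp
      then obtain L1 w' L2 where "L = L1 @ w' # L2" "{u, v} \<subseteq> run L1 (step w A)"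
        "\<not> {u, v} \<subseteq> step w' (run L1 (step w A))" using Cons.IH[OF True] by blast
      then have "w # L = (w # L1) @ w' # L2" "{u, v} \<subseteq> run (w # L1) A"
        "\<not> {u, v} \<subseteq> step w' (run (w # L1) A)" by simp_all
      then show ?thesis by blast
    next
      case False
      then have "w # L = [] @ w # L" "{u, v} \<subseteq> run [] A" "\<not> {u, v} \<subseteq> step w (run [] A)"
        using Cons.prems(1) by simp_all
      then show ?thesis by blast
    qed
  qed simp
  obtain L1 w L2 where L: "pre t = L1 @ w # L2" "{u, v} \<subseteq> run L1 V" "\<not> {u, v} \<subseteq> step w (run L1 V)"
    using ex[of V "pre t"] assms uvV by (auto simp: free_def R_def)
  have w: "w \<in> set (pre t)" using L by simp
  then have wL: "w \<in> set Ls" "y w < t" by (auto simp: pre_def)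
  have srt: "sorted_wrt (\<lambda>a b. y a < y b) (pre t)" unfolding pre_def using sorted by (rule sorted_wrt_filter)
  have "pre (y w) = filter (\<lambda>x. y x < y w) (pre t)"
    unfolding pre_def using wL by (auto intro!: filter_cong)
  also have "\<dots> = L1"
    using srt by (auto simp: L sorted_wrt_append filter_id_conv filter_empty_conv)
  finally have R: "R (y w) = run L1 V" by (simp add: R_def)
  have fr: "free (y w)" using L R by (auto simp: free_def)
  have "w \<noteq> u" "w \<noteq> v" using wL u_notin v_notin by auto
  then have "w \<in> R (y w)" "N w \<inter> R (y w) \<noteq> {}" "top w (N w \<inter> R (y w)) = u \<or> top w (N w \<inter> R (y w)) = v"
    using L R by (auto simp: step_def split: if_splits)
  moreover from this have "top w (N w \<inter> R (y w)) \<in> N w" using top_Int by blast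
  ultimately show ?thesis using that[OF wL fr] N_sym by metis
qed

end

section \<open>The share functions\<close>

text \<open>
  A match made at time \<open>t\<close> gives \<open>al t\<close> to the active and \<open>be t\<close> to the passive endpoint. The
  quadratic approximates the solution of the differential equation that makes \<open>base\<close> below
  constant, and \<open>ka\<close> is chosen such that \<open>2 * (1 - t) * ka t\<close> is the extra gain \<open>slack t\<close> needed there.
\<close>

definition cut :: "real \<Rightarrow> real" where "cut t = max 0 (min t (2/3))"
definition be :: "real \<Rightarrow> real" where "be t = 0.532 + 0.12 * cut t + 0.123 * (cut t)\<^sup>2"
definition al :: "real \<Rightarrow> real" where "al t = 1 - be t"
definition ka :: "real \<Rightarrow> real" where "ka t = cut t * al t / (2 * (1 - cut t))"
definition slack :: "real \<Rightarrow> real" where "slack t = 2 * (1 - t) * ka t"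

lemma cut_bounds: "0 \<le> cut t" "cut t \<le> 2/3"
  by (auto simp: cut_def)

lemma cut_mono: "s \<le> t \<Longrightarrow> cut s \<le> cut t"
  by (auto simp: cut_def)

lemma be_mono: "s \<le> t \<Longrightarrow> be s \<le> be t"
  unfolding be_def using cut_mono[of s t] cut_bounds[of s]
  by (intro add_mono mult_left_mono power_mono) auto

lemma be_bounds: "0.532 \<le> be t" "be t \<le> 2/3"
proof -
  show "0.532 \<le> be t" using cut_bounds[of t] by (simp add: be_def)
  have "(cut t)\<^sup>2 \<le> (2/3)\<^sup>2" using cut_bounds[of t] by (intro power_mono) auto
  then show "be t \<le> 2/3" using cut_bounds[of t] by (simp add: be_def power2_eq_square)
qed

lemma al_bounds: "1/3 \<le> al t" "al t \<le> 0.468"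
  using be_bounds[of t] by (auto simp: al_def)

lemma al_antimono: "s \<le> t \<Longrightarrow> al t \<le> al s"
  using be_mono[of s t] by (simp add: al_def)

lemma al_1: "al 1 = 1/3"
  by (simp add: al_def be_def cut_def power2_eq_square)

lemma ka_nonneg: "0 \<le> ka t"
  using cut_bounds[of t] al_bounds[of t] by (simp add: ka_def)

text \<open>The difference has the factor \<open>2/3 - c\<close>: equality holds at 2/3, and the
  uncut formulas would violate the inequality just beyond. This is the reason for
  \<open>cut\<close>.\<close>

lemma ka_le: "al t \<le> be t - ka t"
proof -
  define c where "c = cut t"
  have c: "0 \<le> c" "c \<le> 2/3" using cut_bounds by (auto simp: c_def)
  have "0 \<le> (2/3 - c) * (0.192 + 0.114 * c + 0.369 * c\<^sup>2)" using c by simp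
  also have "\<dots> = 2 * (1 - c) * (be t - al t) - c * al t"
    by (simp add: al_def be_def c_def[symmetric] field_simps power2_eq_square)
  finally have "c * al t \<le> 2 * (1 - c) * (be t - al t)" by simp
  then have "ka t \<le> be t - al t"
    using c by (simp add: ka_def c_def[symmetric] pos_divide_le_eq mult.commute)
  then show ?thesis by simp
qed

lemma slack_low: "0 \<le> t \<Longrightarrow> t \<le> 2/3 \<Longrightarrow> slack t = t * al t"
  by (simp add: slack_def ka_def cut_def)

lemma slack_high: "2/3 \<le> t \<Longrightarrow> slack t = 2 * (1 - t) / 3"
  by (simp add: slack_def ka_def cut_def al_def be_def power2_eq_square)

lemma al_high: "2/3 \<le> t \<Longrightarrow> al t = 1/3"
  by (simp add: cut_def al_def be_def power2_eq_square)

text \<open>The right side is what a second actor at \<open>t\<close> adds over all earlier ranks of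
  its partner. Equality holds up to 2/3; beyond, the claim reduces to
  \<open>2 * (1 - t) \<le> t\<close>.\<close>

lemma slack_le_al:
  assumes "0 \<le> t"
  shows "slack t \<le> t * al t"
  using assms by (cases "t \<le> 2/3") (auto simp: slack_low slack_high al_high)

text \<open>The right side is what a first actor at \<open>t\<close> adds by taking its partner,
  over all later ranks of the latter. Up to 2/3 the claim amounts to
  \<open>t \<le> be t\<close>.\<close>

lemma slack_le_be:
  assumes "0 \<le> t" "t \<le> 1"
  shows "slack t \<le> (1 - t) * be t"
proof (cases "t \<le> 2/3")
  case True
  have "cut t = t" using assms True by (auto simp: cut_def)
  have "t \<le> be t"
  proof -
    \<comment> \<open>The quadratic \<open>be t - t\<close> has the roots 2/3 and 532/82.\<close>
    have "0 \<le> 0.123 * (2/3 - t) * ((532/1000) / (82/1000) - t)" using True by simp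
    also have "\<dots> = 0.532 + 0.12 * t + 0.123 * t\<^sup>2 - t" by (simp add: field_simps power2_eq_square)
    finally show ?thesis using \<open>cut t = t\<close> by (simp add: be_def)
  qed
  then show ?thesis using True assms by (simp add: slack_low al_def algebra_simps)
next
  case False
  then have "be t = 2/3" "slack t = 2 * (1 - t) / 3" using slack_high[of t] al_high[of t] by (simp_all add: al_def)
  then show ?thesis by (simp only:)
qed

lemma continuous_shares [continuous_intros]:
  "continuous_on S al" "continuous_on S be" "continuous_on S ka" "continuous_on S slack"
proof -
  have c: "continuous_on S cut" for S unfolding cut_def by (intro continuous_intros)
  show b: "continuous_on S be" for S unfolding be_def by (intro continuous_intros c)
  show a: "continuous_on S al" for S unfolding al_def by (intro continuous_intros b)
  have "1 - cut t \<noteq> 0" for t using cut_bounds[of t] by auto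
  then show k: "continuous_on S ka" for S unfolding ka_def by (intro continuous_intros c a) auto
  show "continuous_on S slack" unfolding slack_def by (intro continuous_intros k)
qed

lemma integrable_of_continuous: "continuous_on {a..b} f \<Longrightarrow> f integrable_on {a..b}" for f :: "real \<Rightarrow> real"
  by (rule integrable_continuous_interval)

text \<open>A common lower bound for all pairs left alone until \<open>p\<close>: the first actor's
  share in both orders, the extra density \<open>slack\<close>, and the passive share
  \<open>be p\<close> on the square where both ranks exceed \<open>p\<close>.\<close>

definition base :: "real \<Rightarrow> real" where
  "base p = integral {0..p} (\<lambda>t. 2 * (al t * (1 - t)) + slack t) + (1 - p)\<^sup>2 * be p"

text \<open>
  Completing the square; the margin is below \<open>0.001\<close>.
\<close>

lemma quartic_nonneg:
  fixes p :: real
  assumes "0 \<le> p"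
  shows "0.531 \<le> 0.532 - 0.008 * p + 0.061 * p^2 - 0.168 * p^3 + 0.15375 * p^4"
proof -
  have "0.532 - 0.008 * p + 0.061 * p^2 - 0.168 * p^3 + 0.15375 * p^4 - 0.531
      = (0.39 * p^2 - 14/65 * p + 0.0186)^2 + 0.00065404 + (6/500000 + 3/10000000 + 1/130000000) * p
        + (0.061 - 196/4225 - 0.78 * 0.0186) * p^2 + 0.00165 * p^4"
    by (simp add: power2_eq_square power3_eq_cube power4_eq_xxxx algebra_simps)
  also have "\<dots> \<ge> 0" using assms by (intro add_nonneg_nonneg mult_nonneg_nonneg) auto
  finally show ?thesis by simp
qed

lemma base_low:
  assumes "0 \<le> p" "p \<le> 2/3"
  shows "base p = 0.532 - 0.008 * p + 0.061 * p^2 - 0.168 * p^3 + 0.15375 * p^4"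
proof -
  let ?F = "\<lambda>t::real. 0.936 * t - 0.354 * t^2 - 0.042 * t^3 + 0.03075 * t^4"
  have "((\<lambda>t. 2 * (al t * (1 - t)) + slack t) has_integral (?F p - ?F 0)) {0..p}"
  proof (rule fundamental_theorem_of_calculus)
    fix t assume t: "t \<in> {0..p}"
    then have "cut t = t" using assms by (auto simp: cut_def)
    then have e: "2 * (al t * (1 - t)) + slack t = 0.936 - 0.708 * t - 0.126 * t^2 + 0.123 * t^3"
      using t assms by (simp add: slack_low al_def be_def power2_eq_square power3_eq_cube field_simps)
    have "(?F has_real_derivative 0.936 - 0.708 * t - 0.126 * t^2 + 0.123 * t^3) (at t within {0..p})"
      by (auto intro!: derivative_eq_intros simp: algebra_simps)
    then show "(?F has_vector_derivative 2 * (al t * (1 - t)) + slack t) (at t within {0..p})"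
      unfolding e has_real_derivative_iff_has_vector_derivative .
  qed (use assms in auto)
  from integral_unique[OF this]
  have i: "integral {0..p} (\<lambda>t. 2 * (al t * (1 - t)) + slack t) = ?F p" by simp
  have "cut p = p" using assms by (auto simp: cut_def)
  then have "base p = ?F p + (1 - p)\<^sup>2 * (0.532 + 0.12 * p + 0.123 * p\<^sup>2)"
    unfolding base_def i by (simp add: be_def)
  also have "\<dots> = 0.532 - 0.008 * p + 0.061 * p^2 - 0.168 * p^3 + 0.15375 * p^4"
    by (simp add: power2_eq_square power3_eq_cube power4_eq_xxxx field_simps)
  finally show ?thesis .
qed

text \<open>Beyond 2/3 the differential equation holds exactly: the integrand is
  \<open>4/3 * (1 - t)\<close>, which offsets the decrease of
  \<open>2/3 * (1 - p)^2\<close>.\<close>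

lemma base_high:
  assumes "2/3 \<le> p" "p \<le> 1"
  shows "base p = base (2/3)"
proof -
  let ?f = "\<lambda>t. 2 * (al t * (1 - t)) + slack t" and ?F = "\<lambda>t::real. - (2/3) * (1 - t)^2"
  have "(?f has_integral (?F p - ?F (2/3))) {2/3..p}"
  proof (rule fundamental_theorem_of_calculus)
    fix t assume t: "t \<in> {2/3..p}"
    then have e: "?f t = 4/3 * (1 - t)" by (simp add: al_high slack_high field_simps)
    have "(?F has_real_derivative 4/3 * (1 - t)) (at t within {2/3..p})"
      by (auto intro!: derivative_eq_intros simp: field_simps)
    then show "(?F has_vector_derivative ?f t) (at t within {2/3..p})"
      unfolding e has_real_derivative_iff_has_vector_derivative .
  qed (use assms in auto)
  from integral_unique[OF this]
  have i: "integral {2/3..p} ?f = ?F p - ?F (2/3)" .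
  have c: "integral {0..2/3} ?f + integral {2/3..p} ?f = integral {0..p} ?f"
    by (rule Henstock_Kurzweil_Integration.integral_combine) (use assms in \<open>auto intro!: integrable_of_continuous continuous_intros\<close>)
  have b: "be p = 2/3" "be (2/3) = 2/3"
    using al_high[of p] al_high[of "2/3"] assms by (simp_all add: al_def)
  have "?F p - ?F (2/3) + (1 - p)\<^sup>2 * (2/3) = (1 - 2/3)\<^sup>2 * (2/3)"
    by (simp add: power2_eq_square field_simps)
  then show ?thesis unfolding base_def c[symmetric] i b by linarith
qed

lemma base_ge: "0 \<le> p \<Longrightarrow> p \<le> 1 \<Longrightarrow> 0.531 \<le> base p"
  using base_low[of p] base_low[of "2/3"] base_high[of p] quartic_nonneg[of p] quartic_nonneg[of "2/3"]
  by (cases "p \<le> 2/3") auto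

text \<open>
  The deficit at \<open>t\<close> between \<open>a\<close> and \<open>a + b\<close> is compensated by the surplus at \<open>a + b - t\<close>.
\<close>

lemma disjoint_singles_integral_ge:
  assumes "0 \<le> b" "b \<le> a" "a \<le> f"
  shows "integral {0..f} (\<lambda>t. t * al t) \<le> integral {0..b} (\<lambda>t. t * al t) + integral {0..a} (\<lambda>t. t * al t)
     + integral {a..f} (\<lambda>t. al t * (t - a)) + integral {a..f} (\<lambda>t. al t * (t - b))"
proof -
  have c: "integral {0..a} (\<lambda>t. t * al t) + integral {a..f} (\<lambda>t. t * al t) = integral {0..f} (\<lambda>t. t * al t)"
    by (rule Henstock_Kurzweil_Integration.integral_combine) (use assms in \<open>auto intro!: integrable_of_continuous continuous_intros\<close>)
  have "((\<lambda>t. al b * t) has_integral (al b * b^2 / 2 - al b * 0^2 / 2)) {0..b}"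
    by (rule fundamental_theorem_of_calculus)
       (use assms in \<open>auto intro!: derivative_eq_intros simp: has_real_derivative_iff_has_vector_derivative[symmetric]\<close>)
  from integral_unique[OF this] have i1: "integral {0..b} (\<lambda>t. al b * t) = al b * b^2 / 2" by simp
  have l1: "integral {0..b} (\<lambda>t. al b * t) \<le> integral {0..b} (\<lambda>t. t * al t)"
    by (rule integral_le) (auto intro!: integrable_of_continuous continuous_intros mult_left_mono al_antimono simp: mult.commute)
  \<comment> \<open>The deficit ends at \<open>a + b\<close>, unless the window ends
    earlier.\<close>
  define h where "h = min f (a + b)"
  have h: "a \<le> h" "h \<le> f" using assms by (auto simp: h_def)
  have "((\<lambda>t. al b * (t - a - b)) has_integral (al b * (h - a - b)^2 / 2 - al b * (a - a - b)^2 / 2)) {a..h}"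
    by (rule fundamental_theorem_of_calculus)
       (use h in \<open>auto intro!: derivative_eq_intros simp: has_real_derivative_iff_has_vector_derivative[symmetric]\<close>)
  from integral_unique[OF this]
  have i2: "integral {a..h} (\<lambda>t. al b * (t - a - b)) = al b * (h - a - b)^2 / 2 - al b * b^2 / 2"
    by simp
  \<comment> \<open>Up to \<open>h\<close> the factor \<open>t - a - b\<close> is not positive, so
    replacing \<open>al t\<close> by the larger \<open>al b\<close> only lowers the integral; on
    \<open>{0..b}\<close> the same constant bounds \<open>al t\<close> from below.\<close>
  have l2: "integral {a..h} (\<lambda>t. al b * (t - a - b)) \<le> integral {a..h} (\<lambda>t. al t * (t - a - b))"
    by (rule integral_le)
       (use assms in \<open>auto intro!: integrable_of_continuous continuous_intros mult_right_mono_neg al_antimono simp: h_def\<close>)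
  have l3: "0 \<le> integral {h..f} (\<lambda>t. al t * (t - a - b))"
  proof (cases "h = f")
    case False
    then have "h = a + b" by (auto simp: h_def)
    then show ?thesis using al_bounds(1)
      by (intro integral_nonneg) (auto intro!: integrable_of_continuous continuous_intros mult_nonneg_nonneg order_trans[OF _ al_bounds(1)])
  qed simp
  have "integral {a..h} (\<lambda>t. al t * (t - a - b)) + integral {h..f} (\<lambda>t. al t * (t - a - b))
      = integral {a..f} (\<lambda>t. al t * (t - a - b))"
    by (rule Henstock_Kurzweil_Integration.integral_combine) (use h in \<open>auto intro!: integrable_of_continuous continuous_intros\<close>)
  moreover have "integral {a..f} (\<lambda>t. al t * (t - a)) + integral {a..f} (\<lambda>t. al t * (t - b))
      = integral {a..f} (\<lambda>t. t * al t) + integral {a..f} (\<lambda>t. al t * (t - a - b))"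
    by (subst (1 2) Henstock_Kurzweil_Integration.integral_add[symmetric])
       (auto intro!: integrable_of_continuous continuous_intros Henstock_Kurzweil_Integration.integral_cong simp: algebra_simps)
  moreover have "0 \<le> al b * (h - a - b)^2 / 2" using al_bounds(1)[of b] by simp
  ultimately show ?thesis using c i1 l1 i2 l2 l3 by linarith
qed

lemma integral_split:
  assumes "0 \<le> a" "a \<le> b" "continuous_on {0..b} f"
  shows "integral {0..b} f = integral {0..a} f + integral {a..b} (f :: real \<Rightarrow> real)"
  using Henstock_Kurzweil_Integration.integral_combine[of 0 a b f] assms integrable_of_continuous by simp

text \<open>At \<open>b\<close> and \<open>a\<close> the two partners stop having two further
  candidates, from \<open>f\<close> on one of them would take the other, and \<open>p\<close> is the
  time of the first outside taker. The terms beyond the first actor's share dominate the integral of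
  \<open>slack\<close> over \<open>{0..f}\<close> and over \<open>{f..p}\<close>, which leaves
  \<open>base p\<close>.\<close>

lemma profile_integrals_ge:
  assumes p: "0 \<le> b" "b \<le> a" "a \<le> f" "f \<le> p" "p \<le> 1"
    and E: "E = (if same then 2 * integral {a..f} (\<lambda>t. ka t * (1 - t))
      else integral {a..f} (\<lambda>t. al t * (t - a)) + integral {a..f} (\<lambda>t. al t * (t - b)))"
  shows "0.531 \<le> 2 * integral {0..p} (\<lambda>t. al t * (1 - t)) + integral {0..b} (\<lambda>t. al t * t)
    + integral {0..a} (\<lambda>t. al t * t) + E + integral {f..p} (\<lambda>t. be t * (1 - t)) + (1 - p)\<^sup>2 * be p"
proof -
  have le: "integral {x..z} slack \<le> integral {x..z} g"
    if "\<And>t. 0 \<le> t \<Longrightarrow> t \<le> 1 \<Longrightarrow> slack t \<le> g t" "0 \<le> x" "z \<le> 1" "continuous_on {x..z} g" for x z g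
    by (rule integral_le) (use that in \<open>auto intro!: integrable_of_continuous continuous_intros\<close>)
  have g1: "slack t \<le> al t * t" if "0 \<le> t" for t using slack_le_al[OF that] by (simp add: mult.commute)
  have g2: "slack t \<le> be t * (1 - t)" if "0 \<le> t" "t \<le> 1" for t using slack_le_be[OF that] by (simp add: mult.commute)
  have b0: "0 \<le> integral {0..b} (\<lambda>t. al t * t)"
    by (intro integral_nonneg) (auto intro!: integrable_of_continuous continuous_intros mult_nonneg_nonneg order_trans[OF _ al_bounds(1)])
  have "integral {0..f} slack \<le> integral {0..b} (\<lambda>t. al t * t) + integral {0..a} (\<lambda>t. al t * t) + E"
  proof (cases same)
    case True
    have "integral {a..f} slack = 2 * integral {a..f} (\<lambda>t. ka t * (1 - t))"
      by (subst Henstock_Kurzweil_Integration.integral_mult_right[symmetric])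
         (auto intro!: Henstock_Kurzweil_Integration.integral_cong simp: slack_def mult_ac)
    moreover have "integral {0..a} slack \<le> integral {0..a} (\<lambda>t. al t * t)"
      by (rule le) (use p g1 in \<open>auto intro!: continuous_intros\<close>)
    moreover have "integral {0..f} slack = integral {0..a} slack + integral {a..f} slack"
      by (rule integral_split) (use p in \<open>auto intro!: continuous_intros\<close>)
    ultimately show ?thesis using True E b0 by simp
  next
    case False
    have "integral {0..f} slack \<le> integral {0..f} (\<lambda>t. al t * t)"
      by (rule le) (use p g1 in \<open>auto intro!: continuous_intros\<close>)
    then show ?thesis using False E disjoint_singles_integral_ge[OF p(1-3)] by (simp add: mult.commute)
  qed
  moreover have "integral {f..p} slack \<le> integral {f..p} (\<lambda>t. be t * (1 - t))"
    by (rule le) (use p g2 in \<open>auto intro!: continuous_intros\<close>)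
  moreover have "integral {0..p} slack = integral {0..f} slack + integral {f..p} slack"
    by (rule integral_split) (use p in \<open>auto intro!: continuous_intros\<close>)
  moreover have "base p = 2 * integral {0..p} (\<lambda>t. al t * (1 - t)) + integral {0..p} slack + (1 - p)\<^sup>2 * be p"
    unfolding base_def
    by (subst Henstock_Kurzweil_Integration.integral_add) (auto intro!: integrable_of_continuous continuous_intros)
  ultimately show ?thesis using base_ge[of p] p by linarith
qed

text \<open>The payment costs \<open>ka p\<close> on a square of side \<open>1 - p\<close>. The
  rectangle of sides \<open>p\<close> and \<open>1 - p\<close>, with value 1/3, covers it because
  \<open>slack p \<le> p * al p\<close>.\<close>

lemma triangle_integrals_ge:
  assumes p: "0 \<le> p" "p \<le> 1"
  shows "0.531 \<le> 2 * integral {0..p} (\<lambda>t. al t * (1 - t)) + integral {0..p} (\<lambda>t. al t * t)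
    + 1/3 * (p * (1 - p)) + (1 - p)\<^sup>2 * (be p - ka p)"
proof -
  have "integral {p..p} (\<lambda>t. be t * (1 - t)) = 0" "integral {0..0} (\<lambda>t. al t * t) = 0" by simp_all
  then have "0.531 \<le> 2 * integral {0..p} (\<lambda>t. al t * (1 - t)) + integral {0..p} (\<lambda>t. al t * t) + (1 - p)\<^sup>2 * be p"
    \<comment> \<open>The instance in which one partner has two further candidates up to
      \<open>p\<close> and nothing is claimed about the other.\<close>
    using profile_integrals_ge[of 0 p p p _ True] p by simp
  moreover have "(1 - p)\<^sup>2 * ka p \<le> 1/3 * (p * (1 - p))"
  proof -
    have "2 * (1 - p) * ka p \<le> p * al p" using slack_le_al[of p] p by (simp add: slack_def)
    also have "\<dots> \<le> p * (2/3)" using p al_bounds(2)[of p] by (intro mult_left_mono) auto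
    finally have "2 * ((1 - p) * ka p) \<le> p * (2/3)" by (simp only: mult.assoc)
    then have "(1 - p) * ka p \<le> p / 3" by linarith
    then have "(1 - p) * ((1 - p) * ka p) \<le> (1 - p) * (p / 3)" using p by (intro mult_left_mono) auto
    then show ?thesis by (simp add: power2_eq_square mult_ac)
  qed
  ultimately show ?thesis by (simp only: right_diff_distrib)
qed

section \<open>Lower bounds for double integrals\<close>

definition has_dbl :: "(real \<Rightarrow> real \<Rightarrow> real) \<Rightarrow> real \<Rightarrow> bool" where
  "has_dbl f I \<longleftrightarrow> (\<lambda>z. f (fst z) (snd z)) \<in> borel_measurable (borel \<Otimes>\<^sub>M borel) \<and> (\<forall>s t. 0 \<le> f s t) \<and>
     0 \<le> I \<and> (\<integral>\<^sup>+s. \<integral>\<^sup>+t. ennreal (f s t) \<partial>lborel \<partial>lborel) = ennreal I"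

text \<open>The strict inequalities leave out the boundary lines, so comparisons are needed only off
  the thresholds and the diagonal.\<close>

definition strip :: "(real \<Rightarrow> real) \<Rightarrow> real \<Rightarrow> real \<Rightarrow> (real \<Rightarrow> real) \<Rightarrow> (real \<Rightarrow> real) \<Rightarrow> real \<Rightarrow> real \<Rightarrow> real" where
  "strip \<phi> lo hi c d s t = (if lo < s \<and> s < hi \<and> c s < t \<and> t < d s then \<phi> s else 0)"

lemma pair_sets: "sets (lborel \<Otimes>\<^sub>M lborel) = sets (borel \<Otimes>\<^sub>M (borel :: real measure) :: (real \<times> real) measure)"
  by (intro sets_pair_measure_cong) simp_all

lemma strip_out:
  assumes "0 \<le> lo" "hi \<le> 1" "\<And>s. lo < s \<Longrightarrow> s < hi \<Longrightarrow> 0 \<le> c s \<and> d s \<le> 1"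
    "\<not> (0 < s \<and> s < 1 \<and> 0 < t \<and> t < 1)"
  shows "strip \<phi> lo hi c d s t = 0"
  using assms(1,2,4) assms(3)[of s] by (auto simp: strip_def)

lemma has_dbl_strip:
  assumes [measurable]: "\<phi> \<in> borel_measurable borel" "c \<in> borel_measurable borel" "d \<in> borel_measurable borel"
    and nn: "\<And>s. 0 \<le> \<phi> s" and "lo \<le> hi" and cd: "\<And>s. lo \<le> s \<Longrightarrow> s \<le> hi \<Longrightarrow> c s \<le> d s"
    and ct: "continuous_on {lo..hi} (\<lambda>s. \<phi> s * (d s - c s))"
  shows "has_dbl (strip \<phi> lo hi c d) (integral {lo..hi} (\<lambda>s. \<phi> s * (d s - c s)))"
  unfolding has_dbl_def
proof (intro conjI allI)
  show "(\<lambda>z. strip \<phi> lo hi c d (fst z) (snd z)) \<in> borel_measurable (borel \<Otimes>\<^sub>M borel)"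
    unfolding strip_def by measurable
  show "0 \<le> strip \<phi> lo hi c d s t" for s t using nn by (simp add: strip_def)
  show "0 \<le> integral {lo..hi} (\<lambda>s. \<phi> s * (d s - c s))"
    by (intro integral_nonneg integrable_of_continuous ct mult_nonneg_nonneg nn) (use cd in auto)
  have in1: "(\<integral>\<^sup>+t. ennreal (strip \<phi> lo hi c d s t) \<partial>lborel) = indicator {lo<..<hi} s * ennreal (\<phi> s * (d s - c s))" for s
  proof (cases "lo < s \<and> s < hi")
    case True
    have "(\<integral>\<^sup>+t. ennreal (strip \<phi> lo hi c d s t) \<partial>lborel) = (\<integral>\<^sup>+t. ennreal (\<phi> s) * indicator {c s<..<d s} t \<partial>lborel)"
      by (intro nn_integral_cong) (use True in \<open>auto simp: strip_def indicator_def\<close>)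
    also have "\<dots> = ennreal (\<phi> s) * ennreal (d s - c s)"
      using cd[of s] True by (subst nn_integral_cmult_indicator) auto
    finally show ?thesis using True nn cd[of s] by (simp add: ennreal_mult)
  next
    case False
    then have "strip \<phi> lo hi c d s = (\<lambda>_. 0)" by (auto simp: strip_def)
    then show ?thesis using False by auto
  qed
  have "(\<integral>\<^sup>+s. \<integral>\<^sup>+t. ennreal (strip \<phi> lo hi c d s t) \<partial>lborel \<partial>lborel)
      = (\<integral>\<^sup>+s. indicator {lo..hi} s * ennreal (\<phi> s * (d s - c s)) \<partial>lborel)"
    unfolding in1
  proof (rule nn_integral_cong_AE)
    show "AE s in lborel. indicator {lo<..<hi} s * ennreal (\<phi> s * (d s - c s))
        = indicator {lo..hi} s * ennreal (\<phi> s * (d s - c s))"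
      using AE_lborel_singleton[of lo] AE_lborel_singleton[of hi]
      by eventually_elim (auto simp: indicator_def)
  qed
  also have "\<dots> = ennreal (integral {lo..hi} (\<lambda>s. \<phi> s * (d s - c s)))"
    unfolding mult.commute[of "indicator _ _"]
    by (rule nn_integral_has_integral_lebesgue')
       (use nn cd ct in \<open>auto intro!: integrable_integral integrable_of_continuous mult_nonneg_nonneg\<close>)
  finally show "(\<integral>\<^sup>+s. \<integral>\<^sup>+t. ennreal (strip \<phi> lo hi c d s t) \<partial>lborel \<partial>lborel)
      = ennreal (integral {lo..hi} (\<lambda>s. \<phi> s * (d s - c s)))" .
qed

lemma has_dbl_swap:
  assumes "has_dbl f I"
  shows "has_dbl (\<lambda>s t. f t s) I"
proof -
  have m: "(\<lambda>z. f (fst z) (snd z)) \<in> borel_measurable (borel \<Otimes>\<^sub>M borel)" using assms by (simp add: has_dbl_def)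
  have m1: "(\<lambda>z. f (snd z) (fst z)) \<in> borel_measurable (borel \<Otimes>\<^sub>M borel)"
    using measurable_compose[OF measurable_pair_swap' m] by (simp add: split_beta)
  have "(\<integral>\<^sup>+s. \<integral>\<^sup>+t. ennreal (f t s) \<partial>lborel \<partial>lborel) = (\<integral>\<^sup>+t. \<integral>\<^sup>+s. ennreal (f t s) \<partial>lborel \<partial>lborel)"
  proof (rule lborel_pair.Fubini')
    have "(\<lambda>z. ennreal (f (fst z) (snd z))) \<in> borel_measurable (lborel \<Otimes>\<^sub>M lborel)"
      using m by (simp cong: measurable_cong_sets add: pair_sets)
    then show "(\<lambda>(t, s). ennreal (f t s)) \<in> borel_measurable (lborel \<Otimes>\<^sub>M lborel)"
      by (simp add: split_beta)
  qed
  then show ?thesis using assms m1 by (simp add: has_dbl_def)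
qed

lemma has_dbl_add:
  assumes "has_dbl f I" "has_dbl g J"
  shows "has_dbl (\<lambda>s t. f s t + g s t) (I + J)"
proof -
  have m [measurable]: "(\<lambda>z. f (fst z) (snd z)) \<in> borel_measurable (borel \<Otimes>\<^sub>M borel)"
      "(\<lambda>z. g (fst z) (snd z)) \<in> borel_measurable (borel \<Otimes>\<^sub>M borel)"
    and nn: "\<And>s t. 0 \<le> f s t" "\<And>s t. 0 \<le> g s t" "0 \<le> I" "0 \<le> J"
    using assms by (auto simp: has_dbl_def)
  have [measurable]: "f s \<in> borel_measurable borel" "g s \<in> borel_measurable borel" for s
    using measurable_compose[OF measurable_Pair1'[of s borel borel] m(1)]
      measurable_compose[OF measurable_Pair1'[of s borel borel] m(2)] by simp_all
  have 1: "(\<lambda>s. \<integral>\<^sup>+t. ennreal (f s t) \<partial>lborel) \<in> borel_measurable lborel"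
    "(\<lambda>s. \<integral>\<^sup>+t. ennreal (g s t) \<partial>lborel) \<in> borel_measurable lborel"
  proof -
    have "(\<lambda>z. ennreal (f (fst z) (snd z))) \<in> borel_measurable (lborel \<Otimes>\<^sub>M lborel)"
      "(\<lambda>z. ennreal (g (fst z) (snd z))) \<in> borel_measurable (lborel \<Otimes>\<^sub>M lborel)"
      using m by (simp_all cong: measurable_cong_sets add: pair_sets)
    then show "(\<lambda>s. \<integral>\<^sup>+t. ennreal (f s t) \<partial>lborel) \<in> borel_measurable lborel"
      "(\<lambda>s. \<integral>\<^sup>+t. ennreal (g s t) \<partial>lborel) \<in> borel_measurable lborel"
      by (intro lborel.borel_measurable_nn_integral; simp add: split_beta)+
  qed
  have "(\<integral>\<^sup>+s. \<integral>\<^sup>+t. ennreal (f s t + g s t) \<partial>lborel \<partial>lborel)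
      = (\<integral>\<^sup>+s. ((\<integral>\<^sup>+t. ennreal (f s t) \<partial>lborel) + (\<integral>\<^sup>+t. ennreal (g s t) \<partial>lborel)) \<partial>lborel)"
    by (intro nn_integral_cong) (simp add: nn ennreal_plus nn_integral_add)
  also have "\<dots> = ennreal I + ennreal J"
    using assms by (subst nn_integral_add[OF 1]) (simp add: has_dbl_def)
  finally show ?thesis using nn unfolding has_dbl_def by (auto simp: ennreal_plus)
qed

text \<open>The exceptional lines through \<open>Y\<close> and the diagonal are null sets, so a
  pointwise comparison elsewhere carries over to the nonnegative integrals.\<close>

lemma has_dbl_le:
  assumes "has_dbl f I" "finite Y" "c \<le> I"
    and le: "\<And>s t. 0 < s \<Longrightarrow> s < 1 \<Longrightarrow> 0 < t \<Longrightarrow> t < 1 \<Longrightarrow> s \<notin> Y \<Longrightarrow> t \<notin> Y \<Longrightarrow> s \<noteq> t \<Longrightarrow> f s t \<le> g s t"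
    and out: "\<And>s t. \<not> (0 < s \<and> s < 1 \<and> 0 < t \<and> t < 1) \<Longrightarrow> f s t = 0"
  shows "ennreal c \<le> (\<integral>\<^sup>+s. (\<integral>\<^sup>+t. ennreal (g s t) * indicator {0..1} t \<partial>lborel) * indicator {0..1} s \<partial>lborel)"
proof -
  have fin: "AE s in lborel. s \<notin> Z" if "finite Z" for Z :: "real set"
    using finite_imp_null_set_lborel[OF that] by (rule AE_not_in)
  have "ennreal c \<le> ennreal I" using assms(3) by (simp add: ennreal_leI)
  also have "\<dots> = (\<integral>\<^sup>+s. \<integral>\<^sup>+t. ennreal (f s t) \<partial>lborel \<partial>lborel)" using assms(1) by (simp add: has_dbl_def)
  also have "\<dots> \<le> (\<integral>\<^sup>+s. (\<integral>\<^sup>+t. ennreal (g s t) * indicator {0..1} t \<partial>lborel) * indicator {0..1} s \<partial>lborel)"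
  proof (rule nn_integral_mono_AE)
    show "AE s in lborel. (\<integral>\<^sup>+t. ennreal (f s t) \<partial>lborel)
        \<le> (\<integral>\<^sup>+t. ennreal (g s t) * indicator {0..1} t \<partial>lborel) * indicator {0..1} s"
      using fin[OF assms(2)]
    proof eventually_elim
      case (elim s)
      show ?case
      proof (cases "0 < s \<and> s < 1")
        case True
        have "(\<integral>\<^sup>+t. ennreal (f s t) \<partial>lborel) \<le> (\<integral>\<^sup>+t. ennreal (g s t) * indicator {0..1} t \<partial>lborel)"
        proof (rule nn_integral_mono_AE)
          have "finite (insert s Y)" using assms(2) by simp
          from fin[OF this] show "AE t in lborel. ennreal (f s t) \<le> ennreal (g s t) * indicator {0..1} t"
          proof eventually_elim
            case (elim t)
            then show ?case using True le[of s t] out[of s t] \<open>s \<notin> Y\<close>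
              by (cases "0 < t \<and> t < 1") (auto intro!: ennreal_leI)
          qed
        qed
        then show ?thesis using True by simp
      next
        case False
        then have "f s = (\<lambda>_. 0)" using out by blast
        then show ?thesis by simp
      qed
    qed
  qed
  finally show ?thesis .
qed

section \<open>Assembling strips for the two situations of a pair\<close>

lemma borel_measurable_shares [measurable]: "al \<in> borel_measurable borel" "be \<in> borel_measurable borel" "ka \<in> borel_measurable borel"
  by (auto intro!: borel_measurable_continuous_onI continuous_intros)

lemma shares_nonneg: "0 \<le> al t" "0 \<le> be t" "0 \<le> be t - ka t"
  using al_bounds(1)[of t] be_bounds(1)[of t] ka_le[of t] by simp_all

text \<open>The strips stand for the first actor in either order, for \<open>u\<close> acting second
  before \<open>p\<close>, for \<open>u\<close> acting after \<open>p\<close> with \<open>v\<close>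
  before it, and for both after \<open>p\<close>. The bound \<open>L\<close> itself is exported so
  that it can also be reflected when \<open>v\<close> is the payer.\<close>

lemma double_triangle_ge:
  assumes "0 \<le> p" "p \<le> 1"
  obtains L I where "has_dbl L I" "0.531 \<le> I"
    "\<And>g s t. (s < t \<Longrightarrow> s < p \<Longrightarrow> al s \<le> g) \<Longrightarrow>
      (t < s \<Longrightarrow> t < p \<Longrightarrow> al t + (if s < p then al s else 1/3) \<le> g) \<Longrightarrow>
      (p < s \<Longrightarrow> p < t \<Longrightarrow> be p - ka p \<le> g) \<Longrightarrow> s \<noteq> t \<Longrightarrow> s \<noteq> p \<Longrightarrow> t \<noteq> p \<Longrightarrow> L s t \<le> g"
    "\<And>s t. \<not> (0 < s \<and> s < 1 \<and> 0 < t \<and> t < 1) \<Longrightarrow> L s t = 0"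
proof -
  note strips = has_dbl_strip[where \<phi> = al and lo = 0 and hi = p and c = "\<lambda>s. s" and d = "\<lambda>_. 1"]
    has_dbl_strip[where \<phi> = al and lo = 0 and hi = p and c = "\<lambda>_. 0" and d = "\<lambda>s. s"]
    has_dbl_strip[where \<phi> = "\<lambda>_. 1/3" and lo = p and hi = 1 and c = "\<lambda>_. 0" and d = "\<lambda>_. p"]
    has_dbl_strip[where \<phi> = "\<lambda>_. be p - ka p" and lo = p and hi = 1 and c = "\<lambda>_. p" and d = "\<lambda>_. 1"]
  have s1: "has_dbl (strip al 0 p (\<lambda>s. s) (\<lambda>_. 1)) (integral {0..p} (\<lambda>t. al t * (1 - t)))"
    by (rule strips) (use assms shares_nonneg in \<open>auto intro!: continuous_intros\<close>)
  have s2: "has_dbl (strip al 0 p (\<lambda>_. 0) (\<lambda>s. s)) (integral {0..p} (\<lambda>t. al t * (t - 0)))"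
    by (rule strips) (use assms shares_nonneg in \<open>auto intro!: continuous_intros\<close>)
  have s3: "has_dbl (strip (\<lambda>_. 1/3) p 1 (\<lambda>_. 0) (\<lambda>_. p)) (integral {p..1} (\<lambda>t. 1/3 * (p - 0)))"
    by (rule strips) (use assms in \<open>auto intro!: continuous_intros\<close>)
  have s4: "has_dbl (strip (\<lambda>_. be p - ka p) p 1 (\<lambda>_. p) (\<lambda>_. 1)) (integral {p..1} (\<lambda>t. (be p - ka p) * (1 - p)))"
    by (rule strips) (use assms shares_nonneg in \<open>auto intro!: continuous_intros\<close>)
  note dbl = has_dbl_add[OF has_dbl_add[OF has_dbl_add[OF has_dbl_add[OF s1 has_dbl_swap[OF s1]] s2] s3] s4]
  show ?thesis
  proof (rule that[OF dbl])
    show "0.531 \<le> integral {0..p} (\<lambda>t. al t * (1 - t)) + integral {0..p} (\<lambda>t. al t * (1 - t))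
       + integral {0..p} (\<lambda>t. al t * (t - 0)) + integral {p..1} (\<lambda>t. 1/3 * (p - 0))
       + integral {p..1} (\<lambda>t. (be p - ka p) * (1 - p))"
      using triangle_integrals_ge[OF assms] assms(2) by (simp add: power2_eq_square mult_ac)
  next
    fix g s t :: real
    assume g: "s < t \<Longrightarrow> s < p \<Longrightarrow> al s \<le> g"
      "t < s \<Longrightarrow> t < p \<Longrightarrow> al t + (if s < p then al s else 1/3) \<le> g"
      "p < s \<Longrightarrow> p < t \<Longrightarrow> be p - ka p \<le> g" "s \<noteq> t" "s \<noteq> p" "t \<noteq> p"
    have "0 \<le> al s" "0 \<le> al t" "0 \<le> be p - ka p" using shares_nonneg by auto
    then have "0 \<le> g" using g by (cases "s < t"; cases "s < p"; cases "t < p"; auto)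
    then show "strip al 0 p (\<lambda>s. s) (\<lambda>_. 1) s t + strip al 0 p (\<lambda>s. s) (\<lambda>_. 1) t s
       + strip al 0 p (\<lambda>_. 0) (\<lambda>s. s) s t + strip (\<lambda>_. 1/3) p 1 (\<lambda>_. 0) (\<lambda>_. p) s t
       + strip (\<lambda>_. be p - ka p) p 1 (\<lambda>_. p) (\<lambda>_. 1) s t \<le> g"
      using g shares_nonneg(1)[of s] shares_nonneg(1)[of t] shares_nonneg(3)[of p] by (auto simp: strip_def split: if_splits)
  next
    fix s t :: real assume "\<not> (0 < s \<and> s < 1 \<and> 0 < t \<and> t < 1)"
    then show "strip al 0 p (\<lambda>s. s) (\<lambda>_. 1) s t + strip al 0 p (\<lambda>s. s) (\<lambda>_. 1) t s
       + strip al 0 p (\<lambda>_. 0) (\<lambda>s. s) s t + strip (\<lambda>_. 1/3) p 1 (\<lambda>_. 0) (\<lambda>_. p) s t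
       + strip (\<lambda>_. be p - ka p) p 1 (\<lambda>_. p) (\<lambda>_. 1) s t = 0"
      using assms by (auto simp: strip_def)
  qed
qed

text \<open>The strips overlap and add up: before \<open>p\<close> the first actor's
  \<open>al\<close> is always present, and on top of it comes the second actor's \<open>al\<close>,
  or the bonus \<open>ka\<close>, or the \<open>be\<close> that completes the unit of a match inside
  the pair.\<close>

lemma double_profile_ge:
  fixes g :: "real \<Rightarrow> real \<Rightarrow> real"
  assumes le: "0 \<le> mu" "0 \<le> mv" "mu \<le> f" "mv \<le> f" "f \<le> p" "p \<le> 1" and Y: "finite Y" "p \<in> Y" "mu \<in> Y" "mv \<in> Y" "f \<in> Y"
    and D: "D = {(s, t). 0 < s \<and> s < 1 \<and> 0 < t \<and> t < 1 \<and> s \<notin> Y \<and> t \<notin> Y \<and> s \<noteq> t}"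
    and g1: "\<And>s t. (s, t) \<in> D \<Longrightarrow> s < t \<Longrightarrow> s < p \<Longrightarrow> al s \<le> g s t"
      "\<And>s t. (s, t) \<in> D \<Longrightarrow> t < s \<Longrightarrow> t < p \<Longrightarrow> al t \<le> g s t"
    and g2: "\<And>s t. (s, t) \<in> D \<Longrightarrow> s < t \<Longrightarrow> t < mv \<Longrightarrow> al s + al t \<le> g s t"
      "\<And>s t. (s, t) \<in> D \<Longrightarrow> t < s \<Longrightarrow> s < mu \<Longrightarrow> al s + al t \<le> g s t"
    and g3: "\<And>s t. (s, t) \<in> D \<Longrightarrow> \<not> same \<Longrightarrow> mu < s \<Longrightarrow> s < t \<Longrightarrow> mv < t \<Longrightarrow> t < f \<Longrightarrow> al s + al t \<le> g s t"
      "\<And>s t. (s, t) \<in> D \<Longrightarrow> \<not> same \<Longrightarrow> mv < t \<Longrightarrow> t < s \<Longrightarrow> mu < s \<Longrightarrow> s < f \<Longrightarrow> al s + al t \<le> g s t"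
    and g4: "\<And>s t. (s, t) \<in> D \<Longrightarrow> same \<Longrightarrow> mu < s \<Longrightarrow> mv < s \<Longrightarrow> s < f \<Longrightarrow> s < t \<Longrightarrow> al s + ka s \<le> g s t"
      "\<And>s t. (s, t) \<in> D \<Longrightarrow> same \<Longrightarrow> mu < t \<Longrightarrow> mv < t \<Longrightarrow> t < f \<Longrightarrow> t < s \<Longrightarrow> al t + ka t \<le> g s t"
    and g5: "(\<forall>s t. (s, t) \<in> D \<longrightarrow> s < t \<longrightarrow> f < s \<longrightarrow> s < p \<longrightarrow> 1 \<le> g s t) \<or>
       (\<forall>s t. (s, t) \<in> D \<longrightarrow> t < s \<longrightarrow> f < t \<longrightarrow> t < p \<longrightarrow> 1 \<le> g s t)"
    and g6: "\<And>s t. (s, t) \<in> D \<Longrightarrow> p < s \<Longrightarrow> p < t \<Longrightarrow> be p \<le> g s t"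
  shows "ennreal 0.531 \<le> (\<integral>\<^sup>+s. (\<integral>\<^sup>+t. ennreal (g s t) * indicator {0..1} t \<partial>lborel) * indicator {0..1} s \<partial>lborel)"
proof -
  define m where "m = max mu mv"
  have m: "mu \<le> m" "mv \<le> m" "m \<le> f" "0 \<le> m" using le by (auto simp: m_def)
  have mY: "m \<in> Y" using Y by (auto simp: m_def max_def)
  define A where "A = strip al 0 p (\<lambda>s. s) (\<lambda>_. 1)"
  define Mu where "Mu = strip al 0 mu (\<lambda>_. 0) (\<lambda>s. s)"
  define Mv where "Mv = strip al 0 mv (\<lambda>_. 0) (\<lambda>s. s)"
  define S1 where "S1 = (if same then strip ka m f (\<lambda>s. s) (\<lambda>_. 1) else strip al m f (\<lambda>_. mv) (\<lambda>s. s))"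
  define S2 where "S2 = (if same then strip ka m f (\<lambda>s. s) (\<lambda>_. 1) else strip al m f (\<lambda>_. mu) (\<lambda>s. s))"
  define F where "F = strip be f p (\<lambda>s. s) (\<lambda>_. 1)"
  define T where "T = strip (\<lambda>_. be p) p 1 (\<lambda>_. p) (\<lambda>_. 1)"
  \<comment> \<open>Only one of the two orders is known to give a full unit after \<open>f\<close>,
    so the strip \<open>F\<close> is put on that side of the diagonal.\<close>
  define left where "left \<longleftrightarrow> (\<forall>s t. (s, t) \<in> D \<longrightarrow> s < t \<longrightarrow> f < s \<longrightarrow> s < p \<longrightarrow> 1 \<le> g s t)"
  define F' where "F' = (if left then F else (\<lambda>s t. F t s))"
  have sA: "has_dbl A (integral {0..p} (\<lambda>t. al t * (1 - t)))"
    unfolding A_def by (rule has_dbl_strip) (use le shares_nonneg in \<open>auto intro!: continuous_intros\<close>)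
  have sMu: "has_dbl Mu (integral {0..mu} (\<lambda>t. al t * (t - 0)))"
    unfolding Mu_def by (rule has_dbl_strip) (use le shares_nonneg in \<open>auto intro!: continuous_intros\<close>)
  have sMv: "has_dbl Mv (integral {0..mv} (\<lambda>t. al t * (t - 0)))"
    unfolding Mv_def by (rule has_dbl_strip) (use le shares_nonneg in \<open>auto intro!: continuous_intros\<close>)
  have sk: "has_dbl (strip ka m f (\<lambda>s. s) (\<lambda>_. 1)) (integral {m..f} (\<lambda>t. ka t * (1 - t)))"
    by (rule has_dbl_strip) (use le m ka_nonneg in \<open>auto intro!: continuous_intros\<close>)
  have sal: "has_dbl (strip al m f (\<lambda>_. x) (\<lambda>s. s)) (integral {m..f} (\<lambda>t. al t * (t - x)))" if "x \<le> m" for x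
    by (rule has_dbl_strip) (use le m shares_nonneg that in \<open>auto intro!: continuous_intros\<close>)
  define E1 where "E1 = (if same then integral {m..f} (\<lambda>t. ka t * (1 - t)) else integral {m..f} (\<lambda>t. al t * (t - mv)))"
  define E2 where "E2 = (if same then integral {m..f} (\<lambda>t. ka t * (1 - t)) else integral {m..f} (\<lambda>t. al t * (t - mu)))"
  have sS: "has_dbl S1 E1" "has_dbl S2 E2" using sk sal m by (auto simp: S1_def S2_def E1_def E2_def)
  have sF0: "has_dbl F (integral {f..p} (\<lambda>t. be t * (1 - t)))"
    unfolding F_def by (rule has_dbl_strip) (use le shares_nonneg in \<open>auto intro!: continuous_intros\<close>)
  then have sF: "has_dbl F' (integral {f..p} (\<lambda>t. be t * (1 - t)))"
    using has_dbl_swap by (simp add: F'_def)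
  have sT: "has_dbl T (integral {p..1} (\<lambda>t. be p * (1 - p)))"
    unfolding T_def by (rule has_dbl_strip) (use le shares_nonneg in \<open>auto intro!: continuous_intros\<close>)
  note dbl = has_dbl_add[OF has_dbl_add[OF has_dbl_add[OF has_dbl_add[OF sA has_dbl_swap[OF sA]]
    has_dbl_add[OF sMu has_dbl_swap[OF sMv]]] has_dbl_add[OF sS(1) has_dbl_swap[OF sS(2)]]] has_dbl_add[OF sF sT]]
  show ?thesis
  proof (rule has_dbl_le[OF dbl Y(1)])
    \<comment> \<open>The one-dimensional inequality expects ordered thresholds; the total is
      symmetric in \<open>mu\<close> and \<open>mv\<close>.\<close>
    have "0.531 \<le> 2 * integral {0..p} (\<lambda>t. al t * (1 - t)) + integral {0..min mu mv} (\<lambda>t. al t * t)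
        + integral {0..m} (\<lambda>t. al t * t) + (E1 + E2) + integral {f..p} (\<lambda>t. be t * (1 - t)) + (1 - p)\<^sup>2 * be p"
      by (rule profile_integrals_ge[where same = same])
         (use le in \<open>auto simp: E1_def E2_def m_def min_def max_def\<close>)
    then show "0.531 \<le> integral {0..p} (\<lambda>t. al t * (1 - t)) + integral {0..p} (\<lambda>t. al t * (1 - t))
       + (integral {0..mu} (\<lambda>t. al t * (t - 0)) + integral {0..mv} (\<lambda>t. al t * (t - 0))) + (E1 + E2)
       + (integral {f..p} (\<lambda>t. be t * (1 - t)) + integral {p..1} (\<lambda>t. be p * (1 - p)))"
      using le by (simp add: power2_eq_square mult_ac m_def min_def max_def split: if_splits)
  next
    fix s t :: real assume st: "0 < s" "s < 1" "0 < t" "t < 1" "s \<notin> Y" "t \<notin> Y" "s \<noteq> t"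
    then have D': "(s, t) \<in> D" using D by auto
    have neq: "s \<noteq> p" "t \<noteq> p" "s \<noteq> m" "t \<noteq> m" "s \<noteq> f" "t \<noteq> f" "s \<noteq> mu" "t \<noteq> mv" using st Y mY by auto
    have ab: "al x + be x = 1" for x by (simp add: al_def)
    show "A s t + A t s + (Mu s t + Mv t s) + (S1 s t + S2 t s) + (F' s t + T s t) \<le> g s t"
    proof (cases "s < t")
      case True
      have z: "A t s = 0" "Mu s t = 0" "S1 s t = (if same \<and> m < s \<and> s < f then ka s else 0)"
        "S2 t s = (if \<not> same \<and> m < t \<and> t < f \<and> mu < s then al t else 0)"
        "A s t = (if s < p then al s else 0)" "Mv t s = (if t < mv then al t else 0)"
        "F' s t = (if left \<and> f < s \<and> s < p then be s else 0)" "T s t = (if p < s then be p else 0)"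
        using True st by (auto simp: A_def Mu_def Mv_def S1_def S2_def F_def F'_def T_def strip_def)
      show ?thesis
        using g1(1)[OF D'] g2(1)[OF D'] g3(1)[OF D'] g4(1)[OF D'] g6[OF D'] True neq m le ab[of s] D'
        unfolding z left_def by (smt (verit))
    next
      case False
      then have True: "t < s" using st by auto
      have z: "A s t = 0" "Mv t s = 0" "S2 t s = (if same \<and> m < t \<and> t < f then ka t else 0)"
        "S1 s t = (if \<not> same \<and> m < s \<and> s < f \<and> mv < t then al s else 0)"
        "A t s = (if t < p then al t else 0)" "Mu s t = (if s < mu then al s else 0)"
        "F' s t = (if \<not> left \<and> f < t \<and> t < p then be t else 0)" "T s t = (if p < t then be p else 0)"
        using True st by (auto simp: A_def Mu_def Mv_def S1_def S2_def F_def F'_def T_def strip_def)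
      have g5': "\<not> left \<Longrightarrow> f < t \<Longrightarrow> t < p \<Longrightarrow> 1 \<le> g s t" using g5 D' True unfolding left_def by blast
      show ?thesis
        using g1(2)[OF D'] g2(2)[OF D'] g3(2)[OF D'] g4(2)[OF D'] g5' g6[OF D'] True neq m le ab[of t]
        unfolding z by (smt (verit))
    qed
  next
    show "A s t + A t s + (Mu s t + Mv t s) + (S1 s t + S2 t s) + (F' s t + T s t) = 0"
      if "\<not> (0 < s \<and> s < 1 \<and> 0 < t \<and> t < 1)" for s t
    proof -
      have "\<not> (0 < t \<and> t < 1 \<and> 0 < s \<and> s < 1)" using that by blast
      with that have "A s t = 0" "A t s = 0" "Mu s t = 0" "Mv t s = 0" "S1 s t = 0" "S2 t s = 0"
        "F s t = 0" "F t s = 0" "T s t = 0"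
        unfolding A_def Mu_def Mv_def S1_def S2_def F_def T_def
        by (simp_all add: strip_out le m less_imp_le order_trans[OF _ le(6)] split: if_split)
           (use le m in \<open>auto intro!: strip_out\<close>)
      then show ?thesis by (simp add: F'_def)
    qed
  qed
qed

section \<open>The expected share of a matched pair\<close>

text \<open>The supremum of the times with \<open>Q\<close>; inserting 0 keeps the set nonempty. The
  value at \<open>x\<close> itself stays open, which does not affect integrals.\<close>

lemma threshold:
  fixes c :: real
  assumes "0 \<le> c" "\<And>s t. 0 \<le> s \<Longrightarrow> s \<le> t \<Longrightarrow> t \<le> c \<Longrightarrow> Q t \<Longrightarrow> Q s"
  obtains x where "0 \<le> x" "x \<le> c" "\<And>t. 0 \<le> t \<Longrightarrow> t < x \<Longrightarrow> Q t" "\<And>t. x < t \<Longrightarrow> t \<le> c \<Longrightarrow> \<not> Q t"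
proof -
  define T where "T = insert 0 {t. 0 \<le> t \<and> t \<le> c \<and> Q t}"
  have T: "bdd_above T" "T \<noteq> {}" "0 \<in> T" using assms(1) by (auto simp: T_def intro!: bdd_aboveI[of _ c])
  show ?thesis
  proof (rule that[of "Sup T"])
    show "0 \<le> Sup T" using T by (intro cSup_upper) auto
    show "Sup T \<le> c" using T assms(1) by (intro cSup_least) (auto simp: T_def)
    show "Q t" if t: "0 \<le> t" "t < Sup T" for t
    proof -
      obtain t' where "t' \<in> T" "t < t'" using t(2) unfolding less_cSup_iff[OF T(2,1)] by blast
      then show ?thesis using assms(2)[of t t'] t(1) by (auto simp: T_def)
    qed
    show "\<not> Q t" if "Sup T < t" "t \<le> c" for t
    proof
      assume "Q t"
      have "0 \<le> Sup T" using T by (intro cSup_upper) auto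
      then have "t \<in> T" using that \<open>Q t\<close> by (auto simp: T_def)
      then show False using cSup_upper[OF _ T(1), of t] that by simp
    qed
  qed
qed

locale ranked_pair = matched_pair N top P al be ka u v Ls y V
  for N :: "'a \<Rightarrow> 'a set" and top P u v Ls y V +
  assumes rank01: "x \<in> set Ls \<Longrightarrow> 0 \<le> y x \<and> y x \<le> 1"
begin

text \<open>Reversing the roles lets every estimate with \<open>u\<close> acting first serve also
  for \<open>v\<close> acting first.\<close>

sublocale swap: matched_pair N top P al be ka v u Ls y V
  by unfold_locales (use uv V u_notin v_notin sorted in auto)

lemma swap_free: "swap.free t = free t"
  by (auto simp: swap.free_def free_def)

lemma swap_sh: "s \<noteq> t \<Longrightarrow> swap.sh q t s = sh q s t"
proof -
  assume "s \<noteq> t"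
  then have "swap.ord t s = ord s t" by (auto simp: swap.ord_def ord_def)
  then show ?thesis using uv by (simp add: swap.sh_def sh_def fun_upd_twist)
qed

text \<open>
  At time \<open>t\<close> the vertex \<open>u\<close> would take \<open>v\<close> itself (\<open>Fu\<close>), or it has two further candidates (\<open>Mu\<close>),
  or exactly one, which it prefers to \<open>v\<close>. Over time \<open>u\<close> moves from \<open>Mu\<close> through the third state to \<open>Fu\<close>.
\<close>

definition gain :: "real \<Rightarrow> real \<Rightarrow> real" where "gain s t = sh u s t + sh v s t"
definition ranks :: "real set" where "ranks = y ` set Ls"
definition Fu :: "real \<Rightarrow> bool" where "Fu t \<longleftrightarrow> top u (N u \<inter> R t) = v"
definition Fv :: "real \<Rightarrow> bool" where "Fv t \<longleftrightarrow> top v (N v \<inter> R t) = u"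
definition Mu :: "real \<Rightarrow> bool" where "Mu t \<longleftrightarrow> (\<exists>a b. {a, b} \<subseteq> N u \<inter> R t - {v} \<and> a \<noteq> b)"
definition Mv :: "real \<Rightarrow> bool" where "Mv t \<longleftrightarrow> (\<exists>a b. {a, b} \<subseteq> N v \<inter> R t - {u} \<and> a \<noteq> b)"

lemma first_u: "free s \<Longrightarrow> s < t \<Longrightarrow> al s \<le> gain s t"
  using sh_first_ge[of s t] sh_nonneg[of v s t] by (simp add: gain_def)

lemma first_v: "free t \<Longrightarrow> t < s \<Longrightarrow> al t \<le> gain s t"
  using swap.sh_first_ge[of t s] sh_nonneg[of u s t] by (simp add: gain_def swap_free swap_sh)

lemma gain_Mv: "free t \<Longrightarrow> s < t \<Longrightarrow> s \<notin> ranks \<Longrightarrow> Mv t \<Longrightarrow> al s + al t \<le> gain s t"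
  unfolding Mv_def gain_def ranks_def using sh_M by blast

lemma gain_Mu: "free s \<Longrightarrow> t < s \<Longrightarrow> t \<notin> ranks \<Longrightarrow> Mu s \<Longrightarrow> al s + al t \<le> gain s t"
proof -
  assume h: "free s" "t < s" "t \<notin> ranks" "Mu s"
  then obtain a b where "{a, b} \<subseteq> N u \<inter> R s - {v}" "a \<noteq> b" unfolding Mu_def by blast
  then have "al t + al s \<le> swap.sh v t s + swap.sh u t s"
    using h by (intro swap.sh_M[of s t a b]) (simp_all add: swap_free ranks_def)
  moreover have "s \<noteq> t" using h by simp
  ultimately show ?thesis unfolding gain_def swap_sh[OF \<open>s \<noteq> t\<close>] by simp
qed

lemma gain_Fu: "free s \<Longrightarrow> s < t \<Longrightarrow> Fu s \<Longrightarrow> gain s t = 1"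
  unfolding Fu_def gain_def using sh_top by simp

lemma gain_Fv: "free t \<Longrightarrow> t < s \<Longrightarrow> Fv t \<Longrightarrow> gain s t = 1"
  unfolding Fv_def gain_def using swap.sh_top[of t s] by (simp add: swap_free swap_sh add.commute)

lemma top_R_mono:
  assumes "s \<le> t" "top q (N q \<inter> R s) = x" "x \<in> R t" "N q \<inter> R s \<noteq> {}"
  shows "top q (N q \<inter> R t) = x"
  using top_Int_mono[OF R_antimono[OF assms(1)], of q] assms by simp

lemma Fu_mono: "s \<le> t \<Longrightarrow> free t \<Longrightarrow> Fu s \<Longrightarrow> Fu t"
  using top_R_mono[of s t u v] free_antimono[of s t] uv by (auto simp: Fu_def free_def)

lemma Fv_mono: "s \<le> t \<Longrightarrow> free t \<Longrightarrow> Fv s \<Longrightarrow> Fv t"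
  using top_R_mono[of s t v u] free_antimono[of s t] uv by (auto simp: Fv_def free_def)

lemma Mu_antimono: "s \<le> t \<Longrightarrow> Mu t \<Longrightarrow> Mu s"
  unfolding Mu_def using R_antimono[of s t] by blast

lemma Mv_antimono: "s \<le> t \<Longrightarrow> Mv t \<Longrightarrow> Mv s"
  unfolding Mv_def using R_antimono[of s t] by blast

lemma single_u:
  assumes "free t" "\<not> Fu t" "\<not> Mu t"
  obtains x where "N u \<inter> R t = {v, x}" "x \<noteq> v" "top u (N u \<inter> R t) = x"
proof (rule that[of "top u (N u \<inter> R t)"])
  let ?x = "top u (N u \<inter> R t)"
  have x: "?x \<in> N u \<inter> R t" "?x \<noteq> v" using act_u[OF assms(1)] assms(2) by (auto simp: Fu_def)
  have "w = ?x" if "w \<in> N u \<inter> R t - {v}" for w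
    using assms(3) x that unfolding Mu_def by blast
  moreover have "v \<in> N u \<inter> R t" using assms(1) uv by (auto simp: free_def)
  ultimately show "N u \<inter> R t = {v, ?x}" using x by blast
qed (use assms(2) in \<open>auto simp: Fu_def\<close>)

lemma single_v:
  assumes "free t" "\<not> Fv t" "\<not> Mv t"
  obtains x where "N v \<inter> R t = {u, x}" "x \<noteq> u" "top v (N v \<inter> R t) = x"
proof (rule that[of "top v (N v \<inter> R t)"])
  let ?x = "top v (N v \<inter> R t)"
  have x: "?x \<in> N v \<inter> R t" "?x \<noteq> u" using swap.act_u[of t] assms(1,2) by (auto simp: Fv_def swap_free)
  have "w = ?x" if "w \<in> N v \<inter> R t - {u}" for w
    using assms(3) x that unfolding Mv_def by blast
  moreover have "u \<in> N v \<inter> R t" using assms(1) uv by (auto simp: free_def)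
  ultimately show "N v \<inter> R t = {u, ?x}" using x by blast
qed (use assms(2) in \<open>auto simp: Fv_def\<close>)

text \<open>Both \<open>w\<close> and its partner are candidates of \<open>u\<close> at time
  \<open>p\<close>, so \<open>Mu\<close> holds up to \<open>p\<close> and a second actor
  \<open>u\<close> is matched there. For \<open>u\<close> acting after \<open>p\<close> and
  \<open>v\<close> before, \<open>sh_robust\<close> supplies the 1/3.\<close>

lemma gain_triangle_taken:
  assumes w: "w \<in> set Ls" "free (y w)" "w \<in> R (y w)" "top w (N w \<inter> R (y w)) = u" "w \<in> N u"
    and tri: "tri w u (R (y w))"
  obtains L I where "has_dbl L I" "0.531 \<le> I"
    "\<And>s t. 0 < s \<Longrightarrow> s < 1 \<Longrightarrow> 0 < t \<Longrightarrow> t < 1 \<Longrightarrow> s \<notin> y ` set Ls \<Longrightarrow> t \<notin> y ` set Ls \<Longrightarrow> s \<noteq> t \<Longrightarrow> L s t \<le> sh u s t + sh v s t"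
    "\<And>s t. \<not> (0 < s \<and> s < 1 \<and> 0 < t \<and> t < 1) \<Longrightarrow> L s t = 0"
proof -
  define p where "p = y w"
  have p: "0 \<le> p" "p \<le> 1" "p \<in> ranks" using rank01[OF w(1)] w(1) by (auto simp: p_def ranks_def)
  have free: "free t" if "t \<le> p" for t using free_antimono[OF that] w by (simp add: p_def)
  obtain w' where w': "P w w'" "w' \<noteq> u" "N w \<inter> R p = {w', u}" "N w' \<inter> R p = {w, u}"
    using tri unfolding tri_def p_def by blast
  have "w \<noteq> u" "w \<noteq> v" using w u_notin v_notin by auto
  then have "w' \<noteq> v" using w'(1) P_uv P_sym P_fun by metis
  have "w \<noteq> w'" "w' \<in> R p" "u \<in> N w'" using w' N_irrefl by auto
  then have "{w, w'} \<subseteq> N u \<inter> R p - {v}" using w w' N_sym \<open>w \<noteq> v\<close> \<open>w' \<noteq> v\<close> by (auto simp: p_def)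
  then have "Mu p" unfolding Mu_def using \<open>w \<noteq> w'\<close> by blast
  then have M: "Mu t" if "t \<le> p" for t using Mu_antimono[OF that] by simp
  obtain L I where L: "has_dbl L I" "0.531 \<le> I"
    "\<And>g s t. (s < t \<Longrightarrow> s < p \<Longrightarrow> al s \<le> g) \<Longrightarrow>
      (t < s \<Longrightarrow> t < p \<Longrightarrow> al t + (if s < p then al s else 1/3) \<le> g) \<Longrightarrow>
      (p < s \<Longrightarrow> p < t \<Longrightarrow> be p - ka p \<le> g) \<Longrightarrow> s \<noteq> t \<Longrightarrow> s \<noteq> p \<Longrightarrow> t \<noteq> p \<Longrightarrow> L s t \<le> g"
    "\<And>s t. \<not> (0 < s \<and> s < 1 \<and> 0 < t \<and> t < 1) \<Longrightarrow> L s t = 0"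
    using double_triangle_ge[OF p(1,2)] by blast
  show ?thesis
  proof (rule that[OF L(1,2) _ L(4)])
    fix s t :: real
    assume "0 < s" "s < 1" "0 < t" "t < 1" "s \<notin> y ` set Ls" "t \<notin> y ` set Ls" "s \<noteq> t"
    then have st: "0 < s" "s < 1" "0 < t" "t < 1" "s \<notin> ranks" "t \<notin> ranks" "s \<noteq> t" by (simp_all add: ranks_def)
    show "L s t \<le> sh u s t + sh v s t" unfolding gain_def[symmetric]
    proof (rule L(3))
      show "al s \<le> gain s t" if "s < t" "s < p" using first_u free that by simp
      show "al t + (if s < p then al s else 1/3) \<le> gain s t" if "t < s" "t < p"
      proof (cases "s < p")
        case True
        then show ?thesis using gain_Mu[of s t] free M that st by (simp add: add.commute)
      next
        case False
        then have "p < s" using st p by (metis linorder_neqE_linordered_idom)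
        have "al 1 \<le> sh u s t"
          by (rule sh_robust[of w]) (use w tri that \<open>p < s\<close> st rank01 set_ord_eq in \<open>auto simp: p_def ranks_def\<close>)
        moreover have "al t \<le> sh v s t" using swap.sh_first_ge[of t s] free that st by (simp add: swap_free swap_sh)
        ultimately show ?thesis using False by (simp add: gain_def al_1)
      qed
      show "be p - ka p \<le> gain s t" if "p < s" "p < t"
        using sh_taken[of w s t] sh_nonneg[of v s t] w tri that by (simp add: p_def gain_def bonus_def)
    qed (use st p in auto)
  qed
qed

text \<open>Serves both for a pair never taken by others, with \<open>p = 1\<close>, and for a pair
  whose first taker is in no triangle, so that the full \<open>be p\<close> is received.\<close>

lemma gain_general:
  assumes p: "0 \<le> p" "p \<le> 1" and free: "\<And>t. t \<le> p \<Longrightarrow> free t"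
    and taken: "\<And>s t. p < s \<Longrightarrow> p < t \<Longrightarrow> s < 1 \<Longrightarrow> t < 1 \<Longrightarrow> s \<noteq> t \<Longrightarrow> be p \<le> gain s t"
  shows "ennreal 0.531 \<le> (\<integral>\<^sup>+s. (\<integral>\<^sup>+t. ennreal (gain s t) * indicator {0..1} t \<partial>lborel) * indicator {0..1} s \<partial>lborel)"
proof -
  have mono: "\<not> Fu s \<and> \<not> Fv s" if "s \<le> t" "t \<le> p" "\<not> Fu t \<and> \<not> Fv t" for s t
    using Fu_mono[OF that(1) free[OF that(2)]] Fv_mono[OF that(1) free[OF that(2)]] that(3) by blast
  obtain f where f: "0 \<le> f" "f \<le> p" "\<And>t. 0 \<le> t \<Longrightarrow> t < f \<Longrightarrow> \<not> Fu t \<and> \<not> Fv t"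
    "\<And>t. f < t \<Longrightarrow> t \<le> p \<Longrightarrow> \<not> (\<not> Fu t \<and> \<not> Fv t)"
    by (rule threshold[OF p(1), of "\<lambda>t. \<not> Fu t \<and> \<not> Fv t"]) (use mono in blast)+
  obtain mu where mu: "0 \<le> mu" "mu \<le> f" "\<And>t. 0 \<le> t \<Longrightarrow> t < mu \<Longrightarrow> Mu t" "\<And>t. mu < t \<Longrightarrow> t \<le> f \<Longrightarrow> \<not> Mu t"
    by (rule threshold[OF f(1), of Mu]) (use Mu_antimono in blast)+
  obtain mv where mv: "0 \<le> mv" "mv \<le> f" "\<And>t. 0 \<le> t \<Longrightarrow> t < mv \<Longrightarrow> Mv t" "\<And>t. mv < t \<Longrightarrow> t \<le> f \<Longrightarrow> \<not> Mv t"
    by (rule threshold[OF f(1), of Mv]) (use Mv_antimono in blast)+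
  define same where "same \<longleftrightarrow> (\<exists>t z. mu < t \<and> mv < t \<and> t < f \<and> N u \<inter> R t = {v, z} \<and> N v \<inter> R t = {u, z})"
  have su: "\<exists>x. N u \<inter> R t = {v, x} \<and> x \<noteq> v \<and> top u (N u \<inter> R t) = x" if "mu < t" "t < f" for t
  proof -
    have "free t" "\<not> Fu t" "\<not> Mu t" using free[of t] f(2) f(3)[of t] mu(1) mu(4)[of t] that by auto
    then show ?thesis using single_u by metis
  qed
  have sv: "\<exists>x. N v \<inter> R t = {u, x} \<and> x \<noteq> u \<and> top v (N v \<inter> R t) = x" if "mv < t" "t < f" for t
  proof -
    have "free t" "\<not> Fv t" "\<not> Mv t" using free[of t] f(2) f(3)[of t] mv(1) mv(4)[of t] that by auto
    then show ?thesis using single_v by metis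
  qed
  have same_z: "\<exists>z. N u \<inter> R t = {v, z} \<and> N v \<inter> R t = {u, z} \<and> top u (N u \<inter> R t) \<noteq> v \<and> top v (N v \<inter> R t) \<noteq> u"
    if s: same "mu < t" "mv < t" "t < f" for t
  proof -
    obtain t0 z where t0: "mu < t0" "mv < t0" "t0 < f" "N u \<inter> R t0 = {v, z}" "N v \<inter> R t0 = {u, z}"
      using s(1) unfolding same_def by blast
    obtain x where x: "N u \<inter> R t = {v, x}" "x \<noteq> v" "top u (N u \<inter> R t) = x" using su[OF s(2,4)] by blast
    obtain x' where x': "N v \<inter> R t = {u, x'}" "x' \<noteq> u" "top v (N v \<inter> R t) = x'" using sv[OF s(3,4)] by blast
    have z: "z \<noteq> v" "z \<noteq> u" using su[OF t0(1,3)] sv[OF t0(2,3)] t0(4,5) by fastforce+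
    \<comment> \<open>States at two times are nested, and in this window each partner has exactly
      one further candidate; so the candidate cannot change, and one common moment makes it common
      throughout.\<close>
    have "R t \<subseteq> R t0 \<or> R t0 \<subseteq> R t" using R_antimono by (cases "t \<le> t0") auto
    then have "x = z \<and> x' = z"
    proof
      assume "R t \<subseteq> R t0"
      then have "x \<in> N u \<inter> R t0" "x' \<in> N v \<inter> R t0" using x x' by blast+
      then show ?thesis unfolding t0(4,5) using x(2) x'(2) by blast
    next
      assume "R t0 \<subseteq> R t"
      then have "z \<in> N u \<inter> R t" "z \<in> N v \<inter> R t" using t0 by blast+
      then show ?thesis unfolding x(1) x'(1) using z by blast
    qed
    then show ?thesis using x x' by auto
  qed
  define Y where "Y = ranks \<union> {p, mu, mv, f}"
  have Y: "finite Y" "p \<in> Y" "mu \<in> Y" "mv \<in> Y" "f \<in> Y" by (auto simp: Y_def ranks_def)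
  note fr = free[OF order_trans[OF less_imp_le f(2)]] free[OF less_imp_le]
  show ?thesis
  proof (rule double_profile_ge[where same = same, OF mu(1) mv(1) mu(2) mv(2) f(2) p(2) Y refl])
    fix s t :: real
    assume "(s, t) \<in> {(s, t). 0 < s \<and> s < 1 \<and> 0 < t \<and> t < 1 \<and> s \<notin> Y \<and> t \<notin> Y \<and> s \<noteq> t}"
    then have st: "0 < s" "s < 1" "0 < t" "t < 1" "s \<notin> ranks" "t \<notin> ranks" "s \<noteq> t" by (auto simp: Y_def)
    show "al s \<le> gain s t" if "s < t" "s < p" using first_u fr that by simp
    show "al t \<le> gain s t" if "t < s" "t < p" using first_v fr that by simp
    show "al s + al t \<le> gain s t" if "s < t" "t < mv"
      using gain_Mv[of t s] fr(1)[of t] mv(2) mv(3)[of t] that st by simp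
    show "al s + al t \<le> gain s t" if "t < s" "s < mu"
      using gain_Mu[of s t] fr(1)[of s] mu(2) mu(3)[of s] that st by simp
    show "al s + al t \<le> gain s t" if h: "\<not> same" "mu < s" "s < t" "mv < t" "t < f"
    proof -
      have l: "s < f" "mu < t" using h by simp_all
      obtain x where x: "N u \<inter> R s = {v, x}" "x \<noteq> v" "top u (N u \<inter> R s) = x" using su[OF h(2) l(1)] by blast
      obtain x1 where x1: "N u \<inter> R t = {v, x1}" "x1 \<noteq> v" using su[OF l(2) h(5)] by blast
      obtain z where z: "N v \<inter> R t = {u, z}" "z \<noteq> u" using sv[OF h(4,5)] by blast
      \<comment> \<open>The single candidate at \<open>t\<close> is already the one at
        \<open>s\<close>; hence the vertex that \<open>u\<close> takes at \<open>s\<close> would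
        have been free at \<open>t\<close>, as \<open>sh_S\<close> requires.\<close>
      have "x1 \<in> N u \<inter> R s" using R_antimono[of s t] x1 h(3) by auto
      then have "x1 = x" unfolding x(1) using x1(2) by blast
      have "z \<noteq> x"
      proof
        assume "z = x"
        then have "N u \<inter> R t = {v, x}" "N v \<inter> R t = {u, x}" "mu < t" using x1(1) z(1) \<open>x1 = x\<close> l by auto
        then show False using h(1,4,5) unfolding same_def by blast
      qed
      moreover have "x \<in> R t" "z \<in> N v \<inter> R t - {u}" using x1 z \<open>x1 = x\<close> by auto
      moreover have "free t" using fr(1)[of t] h by simp
      ultimately show ?thesis
        unfolding gain_def using st(5) h(3) x(3) by (intro sh_S[of t s z]) (simp_all add: ranks_def)
    qed
    show "al s + al t \<le> gain s t" if h: "\<not> same" "mv < t" "t < s" "mu < s" "s < f"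
    proof -
      have l: "t < f" "mv < s" using h by simp_all
      obtain x where x: "N v \<inter> R t = {u, x}" "x \<noteq> u" "top v (N v \<inter> R t) = x" using sv[OF h(2) l(1)] by blast
      obtain x1 where x1: "N v \<inter> R s = {u, x1}" "x1 \<noteq> u" using sv[OF l(2) h(5)] by blast
      obtain z where z: "N u \<inter> R s = {v, z}" "z \<noteq> v" using su[OF h(4,5)] by blast
      have "x1 \<in> N v \<inter> R t" using R_antimono[of t s] x1 h(3) by auto
      then have "x1 = x" unfolding x(1) using x1(2) by blast
      have "z \<noteq> x"
      proof
        assume "z = x"
        then have "N u \<inter> R s = {v, x}" "N v \<inter> R s = {u, x}" "mv < s" using x1(1) z(1) \<open>x1 = x\<close> l by auto
        then show False using h(1,4,5) unfolding same_def by blast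
      qed
      moreover have "x \<in> R s" "z \<in> N u \<inter> R s - {v}" using x1 z \<open>x1 = x\<close> by auto
      moreover have "free s" using fr(1)[of s] h by simp
      ultimately have "al t + al s \<le> swap.sh v t s + swap.sh u t s"
        using st(6) h(3) x(3) by (intro swap.sh_S[of s t z]) (simp_all add: ranks_def swap_free)
      then show ?thesis unfolding gain_def swap_sh[OF st(7)] by simp
    qed
    show "al s + ka s \<le> gain s t" if h: same "mu < s" "mv < s" "s < f" "s < t"
    proof -
      obtain z where "N u \<inter> R s = {v, z}" "N v \<inter> R s = {u, z}" "top u (N u \<inter> R s) \<noteq> v"
        using same_z h by blast
      then have "al s + ka s \<le> sh u s t" using sh_triangle[of s t z] fr(1)[of s] h by simp
      then show ?thesis using sh_nonneg[of v s t] by (simp add: gain_def)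
    qed
    show "al t + ka t \<le> gain s t" if h: same "mu < t" "mv < t" "t < f" "t < s"
    proof -
      obtain z where "N u \<inter> R t = {v, z}" "N v \<inter> R t = {u, z}" "top v (N v \<inter> R t) \<noteq> u"
        using same_z h by blast
      then have "al t + ka t \<le> swap.sh v t s" using swap.sh_triangle[of t s z] fr(1)[of t] h by (simp add: swap_free)
      then show ?thesis using sh_nonneg[of u s t] st by (simp add: gain_def swap_sh)
    qed
    show "be p \<le> gain s t" if "p < s" "p < t" using taken that st by simp
  next
    show "(\<forall>s t. (s, t) \<in> {(s, t). 0 < s \<and> s < 1 \<and> 0 < t \<and> t < 1 \<and> s \<notin> Y \<and> t \<notin> Y \<and> s \<noteq> t} \<longrightarrow>
          s < t \<longrightarrow> f < s \<longrightarrow> s < p \<longrightarrow> 1 \<le> gain s t) \<or>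
        (\<forall>s t. (s, t) \<in> {(s, t). 0 < s \<and> s < 1 \<and> 0 < t \<and> t < 1 \<and> s \<notin> Y \<and> t \<notin> Y \<and> s \<noteq> t} \<longrightarrow>
          t < s \<longrightarrow> f < t \<longrightarrow> t < p \<longrightarrow> 1 \<le> gain s t)"
    proof (cases "\<forall>t. f < t \<longrightarrow> t < p \<longrightarrow> Fu t")
      case True
      then have "1 \<le> gain s t" if "s < t" "f < s" "s < p" for s t
        using gain_Fu[OF fr(2)[OF that(3)] that(1)] that by simp
      then show ?thesis by blast
    next
      case False
      then obtain t1 where t1: "f < t1" "t1 < p" "\<not> Fu t1" by blast
      \<comment> \<open>Where \<open>Fu\<close> fails after \<open>f\<close>, \<open>Fv\<close> must
        hold. Failure of \<open>Fu\<close> at \<open>t1\<close> extends to earlier times, and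
        \<open>Fv\<close> at \<open>t1\<close> extends to later ones.\<close>
      have "Fv t" if "f < t" "t < p" for t
      proof (cases "t \<le> t1")
        case True
        then have "\<not> Fu t" using Fu_mono[of t t1] fr(2)[of t1] t1 by blast
        then show ?thesis using f(4)[OF that(1) less_imp_le[OF that(2)]] by blast
      next
        case False
        then show ?thesis using Fv_mono[of t1 t] f(4)[of t1] t1 fr(2)[of t] that by auto
      qed
      then have "1 \<le> gain s t" if "t < s" "f < t" "t < p" for s t
        using gain_Fv[OF fr(2)[OF that(3)] that(1)] that by simp
      then show ?thesis by blast
    qed
  qed
qed

lemma swap_ranked: "ranked_pair N top P v u Ls y V"
  by unfold_locales (use rank01 in auto)

lemma gain_ge:
  "ennreal 0.531 \<le> (\<integral>\<^sup>+s. (\<integral>\<^sup>+t. ennreal (gain s t) * indicator {0..1} t \<partial>lborel) * indicator {0..1} s \<partial>lborel)"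
\<comment> \<open>No rank exceeds 1, so \<open>free 2\<close> means that no other vertex ever takes
  \<open>u\<close> or \<open>v\<close>; with \<open>p = 1\<close> the premise about ranks after
  \<open>p\<close> is vacuous.\<close>
proof (cases "free 2")
  case True
  then show ?thesis using free_antimono[of _ 2] by (intro gain_general[of 1]) auto
next
  case False
  obtain w where w: "w \<in> set Ls" "free (y w)" "w \<in> R (y w)"
    "top w (N w \<inter> R (y w)) = u \<and> w \<in> N u \<or> top w (N w \<inter> R (y w)) = v \<and> w \<in> N v"
    using taker_exists[OF False] by blast
  let ?p = "y w"
  have fin: "finite ranks" by (simp add: ranks_def)
  have p: "0 \<le> ?p" "?p \<le> 1" "\<And>t. t \<le> ?p \<Longrightarrow> free t" using rank01[OF w(1)] free_antimono w(2) by blast+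
  from w(4) show ?thesis
  proof
    assume u: "top w (N w \<inter> R (y w)) = u \<and> w \<in> N u"
    show ?thesis
    proof (cases "tri w u (R ?p)")
      case True
      obtain L I where L: "has_dbl L I" "0.531 \<le> I"
        "\<And>s t. 0 < s \<Longrightarrow> s < 1 \<Longrightarrow> 0 < t \<Longrightarrow> t < 1 \<Longrightarrow> s \<notin> ranks \<Longrightarrow> t \<notin> ranks \<Longrightarrow> s \<noteq> t \<Longrightarrow> L s t \<le> gain s t"
        "\<And>s t. \<not> (0 < s \<and> s < 1 \<and> 0 < t \<and> t < 1) \<Longrightarrow> L s t = 0"
        using gain_triangle_taken[OF w(1-3) _ _ True] u unfolding gain_def ranks_def by blast
      show ?thesis by (rule has_dbl_le[OF L(1) fin L(2)]) (use L in auto)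
    next
      case False
      have "be ?p \<le> gain s t" if "?p < s" "?p < t" for s t
        using sh_taken[of w s t] sh_nonneg[of v s t] w u that False by (simp add: gain_def bonus_def)
      then show ?thesis using p by (intro gain_general) auto
    qed
  next
    assume v: "top w (N w \<inter> R (y w)) = v \<and> w \<in> N v"
    show ?thesis
    proof (cases "tri w v (R ?p)")
      case True
      obtain L I where L: "has_dbl L I" "0.531 \<le> I"
        "\<And>s t. 0 < s \<Longrightarrow> s < 1 \<Longrightarrow> 0 < t \<Longrightarrow> t < 1 \<Longrightarrow> s \<notin> y ` set Ls \<Longrightarrow> t \<notin> y ` set Ls \<Longrightarrow>
          s \<noteq> t \<Longrightarrow> L s t \<le> swap.sh v s t + swap.sh u s t"
        "\<And>s t. \<not> (0 < s \<and> s < 1 \<and> 0 < t \<and> t < 1) \<Longrightarrow> L s t = 0"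
        using ranked_pair.gain_triangle_taken[OF swap_ranked w(1) _ w(3) _ _ True] w(2) v unfolding swap_free by blast
      show ?thesis
      proof (rule has_dbl_le[OF has_dbl_swap[OF L(1)] fin L(2)])
        fix s t :: real assume "0 < s" "s < 1" "0 < t" "t < 1" "s \<notin> ranks" "t \<notin> ranks" "s \<noteq> t"
        then show "L t s \<le> gain s t"
          using L(3)[of t s] by (simp add: gain_def ranks_def swap_sh)
      qed (use L(4) in blast)
    next
      case False
      have "be ?p \<le> gain s t" if "?p < s" "?p < t" "s \<noteq> t" for s t
      proof -
        have "be ?p - bonus w v (R ?p) ?p \<le> swap.sh v t s"
          by (rule swap.sh_taken[of w t s]) (use w v that in \<open>auto simp: swap_free\<close>)
        then show ?thesis using False sh_nonneg[of u s t] unfolding gain_def swap_sh[OF that(3)] by (simp add: bonus_def)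
      qed
      then show ?thesis using p by (intro gain_general) auto
    qed
  qed
qed

end

section \<open>Random ranks\<close>

lemma first_in_unique:
  assumes "strict_linear_order_on B r" "X \<subseteq> B" "finite X" "X \<noteq> {}"
  shows "\<exists>!v. v \<in> X \<and> (\<forall>w \<in> X - {v}. (v, w) \<in> r)"
proof -
  have r: "trans r" "irrefl r" "total_on B r" using assms(1) by (auto simp: strict_linear_order_on_def)
  have "\<exists>v. v \<in> X \<and> (\<forall>w \<in> X - {v}. (v, w) \<in> r)"
    using assms(3,4,2)
  proof (induction X rule: finite_ne_induct)
    case (insert x X)
    then obtain v where v: "v \<in> X" "\<forall>w \<in> X - {v}. (v, w) \<in> r" by auto
    then have "x \<noteq> v" using insert by auto
    then have "(x, v) \<in> r \<or> (v, x) \<in> r" using r(3) insert.prems v by (auto simp: total_on_def)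
    then show ?case
    proof
      assume "(x, v) \<in> r"
      then have "(x, w) \<in> r" if "w \<in> X" for w using v that transD[OF r(1)] by (cases "w = v") auto
      then show ?thesis by auto
    next
      assume "(v, x) \<in> r"
      then show ?thesis using v by auto
    qed
  qed auto
  moreover have "v = v'" if "v \<in> X" "\<forall>w \<in> X - {v}. (v, w) \<in> r" "v' \<in> X" "\<forall>w \<in> X - {v'}. (v', w) \<in> r" for v v'
  proof (rule ccontr)
    assume "v \<noteq> v'"
    then have "(v, v') \<in> r" "(v', v) \<in> r" using that by auto
    then show False using transD[OF r(1)] r(2) by (auto simp: irrefl_def)
  qed
  ultimately show ?thesis by blast
qed

lemma decision_order_eq:
  assumes "set us = V" "distinct us" "sorted (map y us)" "inj_on y V"
  shows "decision_order V y = us"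
  unfolding decision_order_def
proof (rule some_equality)
  show "set us = V \<and> distinct us \<and> sorted (map y us)" using assms by simp
next
  fix us' assume us': "set us' = V \<and> distinct us' \<and> sorted (map y us')"
  then have "map y us' = map y us"
    using assms by (intro sorted_distinct_set_unique) (auto simp: distinct_map)
  then show "us' = us"
    using us' assms by (intro inj_on_map_eq_map[THEN iffD1, of y us' us]) (auto simp: inj_on_def)
qed

lemma decision_order_exists:
  assumes "finite V"
  shows "set (decision_order V y) = V \<and> distinct (decision_order V y) \<and> sorted (map y (decision_order V y))"
proof -
  obtain us where "set us = V" "distinct us" using finite_distinct_list[OF assms] by blast
  then have "\<exists>us. set us = V \<and> distinct us \<and> sorted (map y us)"
    by (intro exI[of _ "sort_key y us"]) simp
  then show ?thesis unfolding decision_order_def by (rule someI_ex)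
qed

section \<open>Independent uniform ranks: almost sure distinctness and measurability\<close>

abbreviation unif :: "real measure" where "unif \<equiv> uniform_measure lborel {0..1}"

lemma prob_space_unif: "prob_space unif"
  by (rule prob_space_uniform_measure) auto

lemma sets_unif [measurable_cong]: "sets unif = sets borel"
  by simp

lemma sigma_finite_unif: "sigma_finite_measure unif"
  by (rule prob_space_imp_sigma_finite[OF prob_space_unif])

interpretation ranks: product_sigma_finite "\<lambda>_. unif"
  by (rule product_sigma_finite.intro) (rule sigma_finite_unif)

lemmas measurable_unif_integral = sigma_finite_measure.borel_measurable_nn_integral[OF sigma_finite_unif]

lemma AE_unif_ne: "AE s in unif. s \<noteq> (c :: real)"
  by (rule AE_uniform_measureI) (use AE_lborel_singleton[of c] in \<open>auto elim: eventually_mono\<close>)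

text \<open>With all ranks but \<open>y j\<close> fixed, a tie with \<open>y i\<close> confines
  \<open>y j\<close> to one point; integrating this coordinate first shows the tie to be a null
  event.\<close>

lemma AE_rank_distinct:
  assumes "finite V"
  shows "AE y in PiM V (\<lambda>_. unif). inj_on y V \<and> (\<forall>i\<in>V. 0 \<le> y i \<and> y i \<le> 1)"
proof -
  have ne: "AE y in PiM V (\<lambda>_. unif). y i \<noteq> y j" if ij: "i \<in> V" "j \<in> V" "i \<noteq> j" for i j
  proof -
    define I where "I = V - {j}"
    have I: "V = insert j I" "finite I" "j \<notin> I" "i \<in> I" using ij assms by (auto simp: I_def)
    have [measurable]: "(\<lambda>y. y k) \<in> borel_measurable (PiM (insert j I) (\<lambda>_. unif))" if "k \<in> insert j I" for k
      using measurable_component_singleton[OF that, of "\<lambda>_. unif"] by (simp cong: measurable_cong_sets)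
    have S: "{y \<in> space (PiM V (\<lambda>_. unif)). y i = y j} \<in> sets (PiM V (\<lambda>_. unif))"
      unfolding I(1) by measurable (use I in auto)
    have "emeasure (PiM V (\<lambda>_. unif)) {y \<in> space (PiM V (\<lambda>_. unif)). y i = y j}
        = (\<integral>\<^sup>+y. indicator {y \<in> space (PiM V (\<lambda>_. unif)). y i = y j} y \<partial>PiM (insert j I) (\<lambda>_. unif))"
      using S I(1) by simp
    also have "\<dots> = (\<integral>\<^sup>+y. \<integral>\<^sup>+s. indicator {y \<in> space (PiM V (\<lambda>_. unif)). y i = y j} (y(j := s)) \<partial>unif \<partial>PiM I (\<lambda>_. unif))"
      by (rule ranks.product_nn_integral_insert) (use I S in auto)
    also have "\<dots> = (\<integral>\<^sup>+y. 0 \<partial>PiM I (\<lambda>_. unif))"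
    proof (rule nn_integral_cong)
      fix y :: "'a \<Rightarrow> real"
      have "i \<noteq> j" using ij by simp
      have "(\<integral>\<^sup>+s. indicator {y \<in> space (PiM V (\<lambda>_. unif)). y i = y j} (y(j := s)) \<partial>unif) = (\<integral>\<^sup>+s. 0 \<partial>unif)"
      proof (rule nn_integral_cong_AE)
        show "AE s in unif. indicator {y \<in> space (PiM V (\<lambda>_. unif)). y i = y j} (y(j := s)) = (0 :: ennreal)"
          using AE_unif_ne[of "y i"] by eventually_elim (use \<open>i \<noteq> j\<close> in \<open>auto simp: indicator_def\<close>)
      qed
      then show "(\<integral>\<^sup>+s. indicator {y \<in> space (PiM V (\<lambda>_. unif)). y i = y j} (y(j := s)) \<partial>unif) = 0" by simp
    qed
    finally have "emeasure (PiM V (\<lambda>_. unif)) {y \<in> space (PiM V (\<lambda>_. unif)). y i = y j} = 0" by simp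
    then show ?thesis by (intro AE_I[OF _ _ S]) auto
  qed
  have "AE y in PiM V (\<lambda>_. unif). \<forall>i\<in>V. \<forall>j\<in>V. i \<noteq> j \<longrightarrow> y i \<noteq> y j"
    using assms ne by (intro AE_finite_allI) auto
  moreover have "AE y in PiM V (\<lambda>_. unif). \<forall>i\<in>V. 0 \<le> y i \<and> y i \<le> 1"
  proof (intro AE_finite_allI assms)
    fix i assume "i \<in> V"
    then show "AE y in PiM V (\<lambda>_. unif). 0 \<le> y i \<and> y i \<le> 1"
      by (intro AE_PiM_component[where P = "\<lambda>x. 0 \<le> x \<and> x \<le> 1"] prob_space_unif AE_uniform_measureI) auto
  qed
  ultimately show ?thesis by eventually_elim (auto simp: inj_on_def)
qed

lemma measurable_rank [measurable]: "k \<in> V \<Longrightarrow> (\<lambda>y. y k) \<in> borel_measurable (PiM V (\<lambda>_. unif))"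
  using measurable_component_singleton[of k V "\<lambda>_. unif"] by (simp cong: measurable_cong_sets)

text \<open>
  On ties the chosen order depends on \<open>y\<close> only through the finite set of sorted lists, so that
  measurability does not hinge on how ties are broken.
\<close>

lemma measurable_decision_order:
  assumes V: "finite V"
    and F: "\<And>us. set us = V \<Longrightarrow> F us \<in> borel_measurable (PiM V (\<lambda>_. unif))"
  shows "(\<lambda>y. F (decision_order V y) y :: real) \<in> borel_measurable (PiM V (\<lambda>_. unif))"
proof -
  define Ord where "Ord = {us. set us = V \<and> distinct us}"
  have fin: "finite Ord" using finite_subset_distinct[OF V] by (rule rev_finite_subset) (auto simp: Ord_def)
  have srt: "Measurable.pred (PiM V (\<lambda>_. unif)) (\<lambda>y. sorted (map y us))" if "us \<in> Ord" for us
  proof -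
    have le: "Measurable.pred (PiM V (\<lambda>_. unif)) (\<lambda>y. y (us ! i) \<le> y (us ! j))"
      if "i < length us" "j < length us" for i j
    proof -
      have "us ! i \<in> V" "us ! j \<in> V" using that \<open>us \<in> Ord\<close> by (auto simp: Ord_def)
      then show ?thesis unfolding pred_def by (intro borel_measurable_le measurable_rank)
    qed
    have eq: "sorted (map y us) \<longleftrightarrow> (\<forall>i\<in>{..<length us}. \<forall>j\<in>{i..<length us}. y (us ! i) \<le> y (us ! j))"
      for y :: "'a \<Rightarrow> real"
      by (auto simp: sorted_iff_nth_mono)
    show ?thesis unfolding eq by (intro pred_intros_finite le) auto
  qed
  define sel :: "'a list set \<Rightarrow> 'a list" where "sel T = (SOME us. us \<in> T)" for T
  have eq: "{y \<in> space (PiM V (\<lambda>_. unif)). decision_order V y = us} \<in> sets (PiM V (\<lambda>_. unif))" for us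
  proof -
    have "decision_order V y = us \<longleftrightarrow>
        (\<exists>T\<in>{T \<in> Pow Ord. sel T = us}. \<forall>us'\<in>Ord. us' \<in> T \<longleftrightarrow> sorted (map y us'))" for y :: "'a \<Rightarrow> real"
    proof -
      define T0 where "T0 = {us \<in> Ord. sorted (map y us)}"
      have d: "decision_order V y = sel T0" by (simp add: decision_order_def Ord_def T0_def sel_def conj_assoc)
      have "T = T0" if "T \<in> Pow Ord" "\<forall>us'\<in>Ord. us' \<in> T \<longleftrightarrow> sorted (map y us')" for T
        using that by (auto simp: T0_def)
      moreover have "T0 \<in> Pow Ord" "\<forall>us'\<in>Ord. us' \<in> T0 \<longleftrightarrow> sorted (map y us')" by (auto simp: T0_def)
      ultimately show ?thesis unfolding d by blast
    qed
    moreover have "Measurable.pred (PiM V (\<lambda>_. unif))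
        (\<lambda>y. \<exists>T\<in>{T \<in> Pow Ord. sel T = us}. \<forall>us'\<in>Ord. us' \<in> T \<longleftrightarrow> sorted (map y us'))"
    proof (intro pred_intros_finite)
      show "finite {T \<in> Pow Ord. sel T = us}" using fin by simp
      show "Measurable.pred (PiM V (\<lambda>_. unif)) (\<lambda>y. us' \<in> T \<longleftrightarrow> sorted (map y us'))" if "us' \<in> Ord" for T us'
        using srt[OF that] by (cases "us' \<in> T") simp_all
    qed (rule fin)
    ultimately show ?thesis by (simp add: pred_def)
  qed
  have A: "(\<lambda>y. \<Sum>us\<in>Ord. F us y * indicator {y \<in> space (PiM V (\<lambda>_. unif)). decision_order V y = us} y)
      \<in> borel_measurable (PiM V (\<lambda>_. unif))"
  proof (rule borel_measurable_sum)
    fix us assume "us \<in> Ord"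
    then have "F us \<in> borel_measurable (PiM V (\<lambda>_. unif))" using F[of us] unfolding Ord_def by blast
    then show "(\<lambda>y. F us y * indicator {y \<in> space (PiM V (\<lambda>_. unif)). decision_order V y = us} y)
        \<in> borel_measurable (PiM V (\<lambda>_. unif))"
      by (intro borel_measurable_times borel_measurable_indicator eq)
  qed
  have B: "(\<Sum>us\<in>Ord. F us y * indicator {y \<in> space (PiM V (\<lambda>_. unif)). decision_order V y = us} y)
      = F (decision_order V y) y" if "y \<in> space (PiM V (\<lambda>_. unif))" for y
  proof -
    have "decision_order V y \<in> Ord" using decision_order_exists[OF V] by (simp add: Ord_def)
    then have "(\<Sum>us\<in>Ord. F us y * indicator {y \<in> space (PiM V (\<lambda>_. unif)). decision_order V y = us} y)
       = (\<Sum>us\<in>Ord. if decision_order V y = us then F us y else 0)"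
      using that by (intro sum.cong refl) (simp only: indicator_simps mem_Collect_eq simp_thms mult_1_right mult_zero_right split: if_split, simp)
    also have "\<dots> = F (decision_order V y) y" using sum.delta'[OF fin, of "decision_order V y" "\<lambda>us. F us y"] \<open>decision_order V y \<in> Ord\<close>
      by (simp only: if_True)
    finally show ?thesis .
  qed
  show ?thesis using measurable_cong[OF B] A by (rule iffD1)
qed

lemma (in matched_pair) sorted_ord:
  assumes "s \<noteq> t" "s \<notin> y ` set Ls" "t \<notin> y ` set Ls"
  shows "sorted_wrt (\<lambda>a b. (y(u := s, v := t)) a < (y(u := s, v := t)) b) (ord s t)"
proof -
  have ne: "x \<noteq> u" "x \<noteq> v" if "x \<in> set Ls" for x using that u_notin v_notin by auto
  have f: "sorted_wrt (\<lambda>a b. (y(u := s, v := t)) a < (y(u := s, v := t)) b) (filter Q Ls)" for Q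
    by (rule sorted_wrt_mono_rel[OF _ sorted_wrt_filter[OF sorted]]) (use ne in auto)
  show ?thesis
    using f ne uv(1) assms(1)
    by (auto simp: ord_def sorted_wrt_append pre_def mid_def post_def)
qed

text \<open>Allows the actual integrand to be replaced by a formula that is valid only when the two
  ranks are distinct from each other and from those of the other vertices.\<close>

lemma double_unif_integral:
  assumes f: "(\<lambda>(s, t). f s t) \<in> borel_measurable (unif \<Otimes>\<^sub>M unif)" and Y: "finite Y"
    and eq: "\<And>s t. s \<notin> Y \<Longrightarrow> t \<notin> Y \<Longrightarrow> s \<noteq> t \<Longrightarrow> f s t = g s t"
  shows "(\<integral>\<^sup>+s. \<integral>\<^sup>+t. f s t \<partial>unif \<partial>unif)
    = (\<integral>\<^sup>+s. (\<integral>\<^sup>+t. g s t * indicator {0..1} t \<partial>lborel) * indicator {0..1} s \<partial>lborel)"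
proof -
  interpret prob_space unif by (rule prob_space_unif)
  have fin: "AE s in lborel. s \<notin> Z" if "finite Z" for Z :: "real set"
    using finite_imp_null_set_lborel[OF that] by (rule AE_not_in)
  have m1: "(\<lambda>t. f s t) \<in> borel_measurable lborel" for s
    using measurable_compose[OF measurable_Pair1'[of s unif unif] f] by (simp cong: measurable_cong_sets)
  have m2: "(\<lambda>s. \<integral>\<^sup>+t. f s t \<partial>unif) \<in> borel_measurable lborel"
    using measurable_unif_integral[OF f] by (simp cong: measurable_cong_sets)
  have "(\<integral>\<^sup>+s. \<integral>\<^sup>+t. f s t \<partial>unif \<partial>unif)
      = (\<integral>\<^sup>+s. (\<integral>\<^sup>+t. f s t * indicator {0..1} t \<partial>lborel) * indicator {0..1} s \<partial>lborel)"
    by (subst nn_integral_uniform_measure[OF m2]) (simp_all add: nn_integral_uniform_measure[OF m1] divide_ennreal_def)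
  also have "\<dots> = (\<integral>\<^sup>+s. (\<integral>\<^sup>+t. g s t * indicator {0..1} t \<partial>lborel) * indicator {0..1} s \<partial>lborel)"
  proof (rule nn_integral_cong_AE)
    show "AE s in lborel. (\<integral>\<^sup>+t. f s t * indicator {0..1} t \<partial>lborel) * indicator {0..1} s
        = (\<integral>\<^sup>+t. g s t * indicator {0..1} t \<partial>lborel) * indicator {0..1} s"
      using fin[OF Y]
    proof eventually_elim
      case (elim s)
      have "finite (insert s Y)" using Y by simp
      from fin[OF this] have "AE t in lborel. f s t * indicator {0..1} t = g s t * indicator {0..1} t"
        by eventually_elim (use eq elim in auto)
      then have "(\<integral>\<^sup>+t. f s t * indicator {0..1} t \<partial>lborel) = (\<integral>\<^sup>+t. g s t * indicator {0..1} t \<partial>lborel)"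
        by (rule nn_integral_cong_AE)
      then show ?case by simp
    qed
  qed
  finally show ?thesis .
qed

section \<open>RDO as an instance of the greedy process\<close>

locale rdo_setting =
  fixes G :: "'a pair_pre_digraph" and pref :: "'a \<Rightarrow> 'a rel" and Mstar :: "'a set set"
  assumes graph: "pair_graph G"
    and pref: "\<And>u. u \<in> pverts G \<Longrightarrow> strict_linear_order_on (pverts G - {u}) (pref u)"
    and Mstar: "matching G Mstar"
begin

abbreviation V :: "'a set" where "V \<equiv> pverts G"
definition N :: "'a \<Rightarrow> 'a set" where "N w = {x. (w, x) \<in> parcs G}"
definition top :: "'a \<Rightarrow> 'a set \<Rightarrow> 'a" where "top w X = first_in (pref w) X"
definition P :: "'a \<Rightarrow> 'a \<Rightarrow> bool" where "P x y \<longleftrightarrow> {x, y} \<in> Mstar"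

lemma Mstar_edge: "e \<in> Mstar \<Longrightarrow> \<exists>a b. e = {a, b} \<and> (a, b) \<in> parcs G"
  using Mstar unfolding matching_def by blast

lemma Mstar_disjoint: "e \<in> Mstar \<Longrightarrow> e' \<in> Mstar \<Longrightarrow> e \<noteq> e' \<Longrightarrow> e \<inter> e' = {}"
  using Mstar pairwiseD[of disjnt Mstar e e'] by (simp add: matching_def disjnt_def)

lemma fin: "finite V"
  using graph by (simp add: pair_graph_def pair_digraph_def pair_fin_digraph_def pair_fin_digraph_axioms_def)

lemma arc_sym: "(x, y) \<in> parcs G \<Longrightarrow> (y, x) \<in> parcs G"
proof -
  interpret pair_graph G by (rule graph)
  show "(x, y) \<in> parcs G \<Longrightarrow> (y, x) \<in> parcs G" by (rule arcs_symmetric)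
qed

lemma N_V: "x \<in> N w \<Longrightarrow> x \<in> V - {w} \<and> w \<in> V"
proof -
  interpret pair_graph G by (rule graph)
  assume "x \<in> N w"
  then have a: "(w, x) \<in> parcs G" by (simp add: N_def)
  then show ?thesis using pair_no_loops[OF a] arc_fst_in_verts[OF a] arc_snd_in_verts[OF a] by auto
qed

lemma top_first:
  assumes "X \<subseteq> N w" "X \<noteq> {}"
  shows "top w X \<in> X \<and> (\<forall>x\<in>X - {top w X}. (top w X, x) \<in> pref w)"
    and "v \<in> X \<Longrightarrow> (\<forall>x\<in>X - {v}. (v, x) \<in> pref w) \<Longrightarrow> top w X = v"
proof -
  have X: "X \<subseteq> V - {w}" "w \<in> V" using assms N_V by blast+
  then have "finite X" using fin finite_subset by blast
  note un = first_in_unique[OF pref[OF X(2)] X(1) this assms(2)]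
  show "top w X \<in> X \<and> (\<forall>x\<in>X - {top w X}. (top w X, x) \<in> pref w)"
    unfolding top_def first_in_def by (rule theI'[OF un])
  show "v \<in> X \<Longrightarrow> (\<forall>x\<in>X - {v}. (v, x) \<in> pref w) \<Longrightarrow> top w X = v"
    unfolding top_def first_in_def using un by (intro the1_equality) auto
qed

sublocale greedy N top
proof
  show "w \<in> N x" if "x \<in> N w" for x w using that arc_sym by (simp add: N_def)
  show "w \<notin> N w" for w using N_V by blast
  show "top w X \<in> X" if "X \<noteq> {}" "X \<subseteq> N w" for X w using top_first(1)[OF that(2,1)] by blast
  show "top w Y = top w X" if "Y \<subseteq> X" "X \<subseteq> N w" "top w X \<in> Y" for Y X w
  proof (rule top_first(2))
    have "X \<noteq> {}" using that by auto
    then show "\<forall>x\<in>Y - {top w X}. (top w X, x) \<in> pref w" using top_first(1)[of X w] that by blast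
  qed (use that in auto)
qed

sublocale greedy_shares N top P al be ka
proof
  show "P y x" if "P x y" for x y using that by (simp add: P_def insert_commute)
  show "y = z" if "P x y" "P x z" for x y z
  proof -
    have "{x, y} = {x, z}" using Mstar_disjoint[of "{x, y}" "{x, z}"] that unfolding P_def by blast
    then show ?thesis by (auto simp: doubleton_eq_iff)
  qed
  show "y \<in> N x" if "P x y" for x y
  proof -
    have "{x, y} \<in> Mstar" using that by (simp only: P_def)
    then have "\<exists>a b. {x, y} = {a, b} \<and> (a, b) \<in> parcs G" by (rule Mstar_edge)
    then have "(x, y) \<in> parcs G" unfolding doubleton_eq_iff using arc_sym by fast
    then show ?thesis unfolding N_def by simp
  qed
qed (use al_antimono shares_nonneg ka_nonneg ka_le in \<open>auto simp: al_def\<close>)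

text \<open>The complement of the matched vertices follows \<open>step\<close>, and each new edge
  removes two vertices from it; this keeps twice the number of edges plus the number of unmatched
  vertices constant.\<close>

lemma rdo_run:
  assumes "set L \<subseteq> V" "\<Union>M \<subseteq> V" "finite M"
  shows "V - \<Union>(fold (rdo_step G pref) L M) = run L (V - \<Union>M) \<and> \<Union>(fold (rdo_step G pref) L M) \<subseteq> V \<and>
    2 * card (fold (rdo_step G pref) L M) + card (run L (V - \<Union>M)) = 2 * card M + card (V - \<Union>M)"
  using assms
proof (induction L arbitrary: M)
  case (Cons w L)
  let ?A = "V - \<Union>M" and ?M = "rdo_step G pref w M"
  have w: "w \<in> V" using Cons.prems by simp
  have un: "unmatched_neighbors G M w = N w \<inter> ?A"
    using N_V by (auto simp: unmatched_neighbors_def N_def)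
  show ?case
  proof (cases "w \<in> ?A \<and> N w \<inter> ?A \<noteq> {}")
    case True
    let ?x = "top w (N w \<inter> ?A)"
    have x: "?x \<in> N w" "?x \<in> ?A" using top_Int[OF conjunct2[OF True]] by simp_all
    have xw: "?x \<noteq> w" using x N_irrefl by auto
    have M: "?M = insert {w, ?x} M" using True by (simp add: rdo_step_def un top_def)
    have s: "step w ?A = ?A - {w, ?x}" unfolding step_def using True by (rule if_P)
    have A: "V - \<Union>?M = step w ?A" unfolding M s by auto
    have U: "\<Union>?M \<subseteq> V" "finite ?M" unfolding M using x(2) w Cons.prems(2,3) by auto
    have "{w, ?x} \<notin> M" using True by blast
    then have c: "card ?M = card M + 1" unfolding M using Cons.prems(3) by simp
    have "?A = insert w (insert ?x (step w ?A))" using s x True by blast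
    moreover have "w \<notin> insert ?x (step w ?A)" "?x \<notin> step w ?A" "finite (step w ?A)"
      using s xw fin by auto
    ultimately have "card ?A = card (step w ?A) + 2" by (metis add_2_eq_Suc' card_insert_disjoint finite_insert)
    then show ?thesis using Cons.IH[OF _ U] Cons.prems(1) c unfolding A by simp
  next
    case False
    then have "?M = M" unfolding rdo_step_def un using w by auto
    moreover have "step w ?A = ?A" unfolding step_def using False by (rule if_not_P)
    ultimately show ?thesis using Cons by simp
  qed
qed simp

lemma card_rdo: "real (card (rdo G pref y)) = (\<Sum>q\<in>V. share q (decision_order V y) V y)"
proof -
  let ?L = "decision_order V y"
  have "set ?L \<subseteq> V" using decision_order_exists[OF fin] by simp
  then have "2 * card (rdo G pref y) + card (run ?L V) = card V"
    using rdo_run[of ?L "{}"] by (simp add: rdo_def)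
  then have "2 * real (card (rdo G pref y)) + real (card (run ?L V)) = real (card V)"
    by (metis of_nat_add of_nat_mult of_nat_numeral)
  then show ?thesis using sum_share[OF fin, of ?L y] by simp
qed

text \<open>For a fixed list the course of the run does not depend on the ranks; they enter only
  through \<open>al\<close>, \<open>be\<close> and \<open>ka\<close>.\<close>

lemma measurable_share:
  "set us \<subseteq> V \<Longrightarrow> (\<lambda>y. share q us A y) \<in> borel_measurable (PiM V (\<lambda>_. unif))"
proof (induction us arbitrary: A)
  case Nil
  show ?case unfolding share.simps by (rule borel_measurable_const)
next
  case (Cons w us)
  let ?B = "borel_measurable (PiM V (\<lambda>_. unif))" and ?x = "top w (N w \<inter> A)"
  have yw: "(\<lambda>y. y w) \<in> ?B" by (rule measurable_rank) (use Cons.prems in simp)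
  have bonus: "(\<lambda>y. bonus w ?x A (y w)) \<in> ?B"
  proof (cases "tri w ?x A")
    case True
    then show ?thesis using measurable_compose[OF yw borel_measurable_shares(3)] by (simp only: bonus_def if_True)
  next
    case False
    then show ?thesis by (simp only: bonus_def if_False borel_measurable_const)
  qed
  have m: "(\<lambda>y. al (y w) + bonus w ?x A (y w)) \<in> ?B" "(\<lambda>y. be (y w) - bonus w ?x A (y w)) \<in> ?B"
    by (rule borel_measurable_add[OF measurable_compose[OF yw borel_measurable_shares(1)] bonus])
       (rule borel_measurable_diff[OF measurable_compose[OF yw borel_measurable_shares(2)] bonus])
  have sub: "set us \<subseteq> V" using Cons.prems by simp
  show ?case
  proof (cases "w \<in> A \<and> N w \<inter> A \<noteq> {}")
    case True
    then have "share q (w # us) A y = (if q = w then al (y w) + bonus w ?x A (y w)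
        else if q = ?x then be (y w) - bonus w ?x A (y w) else share q us (step w A) y)" for y
      unfolding share.simps by (rule if_P)
    then show ?thesis using m Cons.IH[OF sub, of "step w A"]
      by (cases "q = w"; cases "q = ?x") (simp_all only: if_True if_False simp_thms)
  next
    case False
    show ?thesis unfolding share_idle[OF False] by (rule Cons.IH[OF sub])
  qed
qed

definition F :: "'a \<Rightarrow> ('a \<Rightarrow> real) \<Rightarrow> real" where "F q y = share q (decision_order V y) V y"

lemma measurable_F [measurable]: "F q \<in> borel_measurable (PiM V (\<lambda>_. unif))"
proof -
  have "(\<lambda>y. share q (decision_order V y) V y) \<in> borel_measurable (PiM V (\<lambda>_. unif))"
  proof (rule measurable_decision_order[OF fin, where F = "\<lambda>us. share q us V"])
    fix us assume "set us = V"
    then have "set us \<subseteq> V" by (rule equalityD1)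
    then show "share q us V \<in> borel_measurable (PiM V (\<lambda>_. unif))" by (rule measurable_share)
  qed
  moreover have "(\<lambda>y. share q (decision_order V y) V y) = F q" by (rule ext) (simp only: F_def)
  ultimately show ?thesis by (simp only:)
qed

text \<open>The ranks of \<open>u\<close> and \<open>v\<close> are integrated innermost. The other
  ranks are then fixed and almost surely distinct, and \<open>gain_ge\<close> applies to each such
  choice.\<close>

lemma pair_ge:
  assumes "P u v"
  shows "ennreal 0.531 \<le> (\<integral>\<^sup>+y. ennreal (F u y + F v y) \<partial>PiM V (\<lambda>_. unif))"
proof -
  have uv: "v \<in> N u" "u \<noteq> v" "u \<in> V" "v \<in> V" using P_N[OF assms] N_V[of v u] by auto
  define I where "I = V - {u, v}"
  have I: "V = insert v (insert u I)" "finite I" "u \<notin> I" "v \<notin> insert u I" using uv fin by (auto simp: I_def)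
  define f where "f y = ennreal (F u y + F v y)" for y
  have f: "f \<in> borel_measurable (PiM (insert v (insert u I)) (\<lambda>_. unif))"
    unfolding f_def I(1)[symmetric]
    by (intro measurable_compose[OF _ measurable_ennreal] borel_measurable_add measurable_F)
  have m: "(\<lambda>(y, t). f (y(v := t))) \<in> borel_measurable (PiM (insert u I) (\<lambda>_. unif) \<Otimes>\<^sub>M unif)"
    using measurable_compose[OF measurable_add_dim f] by (simp add: split_beta)
  interpret prob_space unif by (rule prob_space_unif)
  have m2: "(\<lambda>y. \<integral>\<^sup>+t. f (y(v := t)) \<partial>unif) \<in> borel_measurable (PiM (insert u I) (\<lambda>_. unif))"
    by (rule measurable_unif_integral[OF m])
  have "(\<integral>\<^sup>+y. f y \<partial>PiM V (\<lambda>_. unif)) = (\<integral>\<^sup>+y. \<integral>\<^sup>+t. f (y(v := t)) \<partial>unif \<partial>PiM (insert u I) (\<lambda>_. unif))"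
    unfolding I(1) by (rule ranks.product_nn_integral_insert) (use I f in auto)
  also have "\<dots> = (\<integral>\<^sup>+x. \<integral>\<^sup>+s. \<integral>\<^sup>+t. f (x(u := s, v := t)) \<partial>unif \<partial>unif \<partial>PiM I (\<lambda>_. unif))"
    by (rule ranks.product_nn_integral_insert) (use I m2 in auto)
  finally have split: "(\<integral>\<^sup>+y. f y \<partial>PiM V (\<lambda>_. unif))
    = (\<integral>\<^sup>+x. \<integral>\<^sup>+s. \<integral>\<^sup>+t. f (x(u := s, v := t)) \<partial>unif \<partial>unif \<partial>PiM I (\<lambda>_. unif))" .
  have inner: "ennreal 0.531 \<le> (\<integral>\<^sup>+s. \<integral>\<^sup>+t. f (x(u := s, v := t)) \<partial>unif \<partial>unif)"
    if x: "x \<in> space (PiM I (\<lambda>_. unif))" "inj_on x I" "\<forall>i\<in>I. 0 \<le> x i \<and> x i \<le> 1" for x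
  proof -
    define Ls where "Ls = decision_order I x"
    have Ls: "set Ls = I" "distinct Ls" "sorted (map x Ls)" using decision_order_exists[OF I(2)] by (auto simp: Ls_def)
    then have "sorted_wrt (<) (map x Ls)" using x(2) by (simp add: strict_sorted_iff distinct_map)
    then have srt: "sorted_wrt (\<lambda>a b. x a < x b) Ls" by (simp add: sorted_wrt_map)
    interpret rp: ranked_pair N top P u v Ls x V
    proof
      show "V = insert u (insert v (set Ls))" unfolding Ls(1) by (subst insert_commute) (rule I(1))
      show "u \<notin> set Ls" "v \<notin> set Ls" unfolding Ls(1) using I(3,4) by simp_all
      show "0 \<le> x i \<and> x i \<le> 1" if "i \<in> set Ls" for i using x(3) that unfolding Ls(1) by blast
    qed (rule assms srt)+
    have eq: "f (x(u := s, v := t)) = ennreal (rp.gain s t)"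
      if st: "s \<notin> x ` set Ls" "t \<notin> x ` set Ls" "s \<noteq> t" for s t
    proof -
      let ?y = "x(u := s, v := t)"
      note so = rp.sorted_ord[OF st(3,1,2)]
      then have "sorted_wrt (<) (map ?y (rp.ord s t))" by (simp add: sorted_wrt_map)
      then have "sorted (map ?y (rp.ord s t))" "distinct (map ?y (rp.ord s t))" by (simp_all add: strict_sorted_iff)
      moreover have "set (rp.ord s t) = V" using rp.set_ord_eq st by blast
      ultimately have "decision_order V ?y = rp.ord s t"
        by (intro decision_order_eq) (auto simp: distinct_map)
      then show ?thesis by (simp add: f_def F_def rp.gain_def rp.sh_def)
    qed
    have "(\<lambda>s. x(u := s)) \<in> measurable unif (PiM (insert u I) (\<lambda>_. unif))"
      using measurable_component_update[OF x(1) I(3)] .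
    then have "(\<lambda>z. (x(u := fst z), snd z)) \<in> measurable (unif \<Otimes>\<^sub>M unif) (PiM (insert u I) (\<lambda>_. unif) \<Otimes>\<^sub>M unif)"
      by (intro measurable_Pair measurable_compose[OF measurable_fst] measurable_snd)
    from measurable_compose[OF this m]
    have mf: "(\<lambda>(s, t). f (x(u := s, v := t))) \<in> borel_measurable (unif \<Otimes>\<^sub>M unif)"
      by (simp add: split_beta)
    show ?thesis
      by (subst double_unif_integral[OF mf, of "x ` set Ls" "\<lambda>s t. ennreal (rp.gain s t)"])
         (use eq rp.gain_ge in auto)
  qed
  have "ennreal 0.531 = (\<integral>\<^sup>+x. ennreal 0.531 \<partial>PiM I (\<lambda>_. unif))"
  proof -
    interpret PI: prob_space "PiM I (\<lambda>_. unif)" by (intro prob_space_PiM prob_space_unif)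
    show ?thesis by (simp add: PI.emeasure_space_1)
  qed
  also have "\<dots> \<le> (\<integral>\<^sup>+x. \<integral>\<^sup>+s. \<integral>\<^sup>+t. f (x(u := s, v := t)) \<partial>unif \<partial>unif \<partial>PiM I (\<lambda>_. unif))"
  proof (rule nn_integral_mono_AE)
    show "AE x in PiM I (\<lambda>_. unif). ennreal 0.531 \<le> (\<integral>\<^sup>+s. \<integral>\<^sup>+t. f (x(u := s, v := t)) \<partial>unif \<partial>unif)"
      using AE_rank_distinct[OF I(2)] AE_space[of "PiM I (\<lambda>_. unif)"]
      by eventually_elim (use inner in auto)
  qed
  finally show ?thesis unfolding f_def[symmetric] split .
qed

lemma Mstar_pair:
  assumes "e \<in> Mstar"
  shows "\<exists>u v. e = {u, v} \<and> P u v \<and> u \<noteq> v \<and> u \<in> V \<and> v \<in> V"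
proof -
  from Mstar_edge[OF assms] obtain u v where e: "e = {u, v}" "(u, v) \<in> parcs G" by iprover
  have "v \<in> N u" unfolding N_def using e(2) by (rule CollectI)
  moreover have "P u v" unfolding P_def using assms e(1) by (simp only:)
  ultimately have "e = {u, v} \<and> P u v \<and> u \<noteq> v \<and> u \<in> V \<and> v \<in> V" using e(1) N_V[of v u] by auto
  then show ?thesis by (intro exI)
qed

text \<open>The edges of \<open>Mstar\<close> are disjoint and shares are nonnegative, so the joint
  shares of its pairs add up to at most the total share, which is the size of the output
  matching.\<close>

lemma expected_rdo_ge:
  "0.531 * real (card Mstar) \<le> (\<integral>y. real (card (rdo G pref y)) \<partial>rank_measure V)"
proof -
  let ?M = "PiM V (\<lambda>_. unif)"
  interpret prob_space ?M by (intro prob_space_PiM prob_space_unif)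
  have c: "real (card (rdo G pref y)) = (\<Sum>q\<in>V. F q y)" for y by (simp add: card_rdo F_def)
  have F0: "0 \<le> F q y" for q y by (simp add: F_def share_nonneg)
  note Ms = Mstar_pair
  have sub: "\<Union>Mstar \<subseteq> V"
  proof (rule Union_least)
    fix e assume "e \<in> Mstar"
    then obtain u v where "e = {u, v}" "u \<in> V" "v \<in> V" using Ms by iprover
    then show "e \<subseteq> V" by simp
  qed
  have finM: "finite Mstar" using finite_UnionD[OF finite_subset[OF sub fin]] .
  have disj: "\<forall>A\<in>Mstar. \<forall>B\<in>Mstar. A \<noteq> B \<longrightarrow> A \<inter> B = {}"
    using Mstar_disjoint by blast
  have finite_e: "\<forall>e\<in>Mstar. finite e" using sub finite_subset[OF _ fin] by blast
  have edge: "ennreal 0.531 \<le> (\<integral>\<^sup>+y. ennreal (\<Sum>q\<in>e. F q y) \<partial>?M)" if e: "e \<in> Mstar" for e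
  proof -
    obtain u v where uv: "e = {u, v}" "P u v" "u \<noteq> v" using Ms[OF e] by iprover
    then have "(\<Sum>q\<in>e. F q y) = F u y + F v y" for y by simp
    then show ?thesis using pair_ge[OF uv(2)] by (simp only:)
  qed
  have "ennreal (0.531 * real (card Mstar)) = ennreal (\<Sum>e\<in>Mstar. 0.531)"
    by (simp add: mult.commute)
  also have "\<dots> = (\<Sum>e\<in>Mstar. ennreal 0.531)"
    by (rule sum_ennreal[symmetric]) simp
  also have "\<dots> \<le> (\<Sum>e\<in>Mstar. \<integral>\<^sup>+y. ennreal (\<Sum>q\<in>e. F q y) \<partial>?M)"
    by (rule sum_mono) (rule edge)
  also have "\<dots> = (\<integral>\<^sup>+y. (\<Sum>e\<in>Mstar. ennreal (\<Sum>q\<in>e. F q y)) \<partial>?M)"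
    by (rule nn_integral_sum[symmetric])
       (intro measurable_compose[OF _ measurable_ennreal] borel_measurable_sum measurable_F)
  also have "\<dots> \<le> (\<integral>\<^sup>+y. ennreal (\<Sum>q\<in>V. F q y) \<partial>?M)"
  proof (rule nn_integral_mono)
    fix y
    have "(\<Sum>e\<in>Mstar. \<Sum>q\<in>e. F q y) = (\<Sum>q\<in>\<Union>Mstar. F q y)"
      using sum.Union_disjoint[OF finite_e disj, of "\<lambda>q. F q y"] by (simp only: comp_def)
    also have "\<dots> \<le> (\<Sum>q\<in>V. F q y)" by (rule sum_mono2[OF fin sub]) (rule F0)
    finally show "(\<Sum>e\<in>Mstar. ennreal (\<Sum>q\<in>e. F q y)) \<le> ennreal (\<Sum>q\<in>V. F q y)"
      by (subst sum_ennreal) (auto intro!: ennreal_leI sum_nonneg F0)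
  qed
  also have "\<dots> = ennreal (\<integral>y. (\<Sum>q\<in>V. F q y) \<partial>?M)"
  proof (rule nn_integral_eq_integral)
    show "integrable ?M (\<lambda>y. \<Sum>q\<in>V. F q y)"
    proof (rule integrable_const_bound[of _ "real (card V)"])
      show "AE y in ?M. norm (\<Sum>q\<in>V. F q y) \<le> real (card V)"
      proof (rule AE_I2)
        fix y
        have "2 * (\<Sum>q\<in>V. F q y) \<le> real (card V)"
          unfolding F_def sum_share[OF fin] by simp
        moreover have "0 \<le> (\<Sum>q\<in>V. F q y)" by (rule sum_nonneg) (rule F0)
        ultimately show "norm (\<Sum>q\<in>V. F q y) \<le> real (card V)" by simp
      qed
    qed (intro borel_measurable_sum measurable_F)
  qed (simp add: F0 sum_nonneg)
  finally show ?thesis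
    by (simp add: c rank_measure_def ennreal_le_iff F0 sum_nonneg)
qed

end

theorem theorem2:
  fixes G :: "'a pair_pre_digraph"
    and pref :: "'a \<Rightarrow> 'a rel"
    and Mstar :: "'a set set"
  assumes "pair_graph G"
    and "\<And>u. u \<in> pverts G \<Longrightarrow> strict_linear_order_on (pverts G - {u}) (pref u)"
    and "maximum_matching G Mstar"
  shows "(\<integral>y. real (card (rdo G pref y)) \<partial>rank_measure (pverts G)) \<ge> 0.531 * real (card Mstar)"
proof -
  interpret rdo_setting G pref Mstar
  proof (rule rdo_setting.intro)
    show "matching G Mstar" using assms(3) unfolding maximum_matching_def by (rule conjunct1)
  qed (rule assms)+
  show ?thesis by (rule expected_rdo_ge)
qed

end
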